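(* Let $\tfrac{\pi}{2}<\alpha<\tfrac{3\pi}{2}$ and $k>0$, with the geometry, the plane waves $u^i,u^r$, the functions $E$, $u^d$, $\Psi$, $g$, and the functions $v^\pm$, $v$ as in the context. Put $$s_{\rm SB}^i=L_{\rm nc}'\tan(\pi-\alpha),\qquad s_{\rm SB}^r=L_{\rm nc}'\tan(\alpha-\pi),\qquad s_{\rm SB}=L_{\rm nc}'|\tan(\pi-\alpha)|\ge 0,$$ $$g^\pm(s)=g\big(s;\,L_{\rm nc}'/\cos(\pi-\alpha),\,\tfrac{\pi}{2}\pm|\pi-\alpha|\big),$$ $$\Psi_{\rm GO}(\mathbf{x}(s))=2\Big[H(s-s_{\rm SB}^i)\frac{\partial u^i}{\partial\mathbf{n}}(\mathbf{x}(s))-H(s_{\rm SB}^r-s)\frac{\partial u^r}{\partial\mathbf{n}}(\mathbf{x}(s))\Big],$$ $$V(s)=2\Big[-H(s-s_{\rm SB})\,g^+(s-s_{\rm SB})+H(s_{\rm SB}-s)\,g^-(s_{\rm SB}-s)-g^-(s+s_{\rm SB})\Big],$$ where $H$ is the Heaviside function: $H(x)=0$ for $x<0$, $H(0)=1/2$, $H(x)=1$ for $x>0$. ($\Psi_{\rm GO}$ is the classical geometrical optics approximation.) Then: (a) For all $s\in[0,L_{\rm nc}]$, $$\Psi(\mathbf{x}(s))=\Psi_{\rm GO}(\mathbf{x}(s))+V(s)\,e^{ikr(s)},$$ and hence, with $\tilde v(s)=v(s)+V(s)$, $$\frac{\partial u}{\partial\mathbf{n}}(\mathbf{x}(s))=\Psi_{\rm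 GO}(\mathbf{x}(s))+v^+(L_{\rm nc}+s)e^{iks}+v^-(L_{\rm nc}-s)e^{-iks}+\tilde v(s)e^{ikr(s)},\qquad s\in[0,L_{\rm nc}].$$ (b) For any $0<\delta<1$ the functions $g^\pm$ are analytic and bounded in $$\mathcal{S}^\delta=\Big\{s\in\mathbb{C}:\ |\mathrm{Im}\,s|<(1-\delta)L_{\rm nc}'\ \text{ and }\ |\arg s|<\arctan\sqrt{(11+5\sqrt5)/2}\Big\};$$ specifically, for any $k_0>0$ there exists $C>0$, depending only on $\delta$ and $k_0L_{\rm nc}'$, such that $$|g^\pm(s)|\le Ck,\qquad s\in\mathcal{S}^\delta,\ k\ge k_0>0.$$
   Context: **Geometry.** $\Omega\subset\mathbb{R}^2$ is the quadrilateral with vertices $\mathbf{R}=(0,0)$, $\mathbf{Q}=(0,-L_{\rm nc}')$, $\mathbf{P}=(-L_{\rm nc},-L_{\rm nc}')$ and $\mathbf{S}$ in the quadrant $\{x_1>0,\ x_2<-L_{\rm nc}'\}$, where $L_{\rm nc},L_{\rm nc}'>0$; its sides are $\Gamma_{\rm nc}'=\mathbf{RQ}$, $\Gamma_{\rm nc}=\mathbf{QP}$, $\Gamma_{\rm c}'=\mathbf{PS}$, $\Gamma_{\rm c}=\mathbf{SR}$ (so the angle at $\mathbf{Q}$ measured outside $\Omega$ is $\pi/2$). $D=\mathbb{R}^2\setminus\overline\Omega$, $\Gamma=\partial\Omega$. On $\Gamma_{\rm nc}$ use arc length $s\in[0,L_{\rm nc}]$ from $\mathbf{Q}$: $\mathbf{x}(s)=(-s,-L_{\rm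 nc}')$; the unit normal into $D$ is $\mathbf{n}=(0,1)$; $r(s)=\sqrt{s^2+L_{\rm nc}'^2}$ is the distance to $\mathbf{R}$. Polar coordinates at $\mathbf{R}$: $\mathbf{x}=r(\sin\theta,-\cos\theta)$, so that $\theta=0$ points along $\Gamma_{\rm nc}'$ and $\theta=2\pi-\arctan(s/L_{\rm nc}')$ on $\Gamma_{\rm nc}$. **Waves.** The incident wave from direction $\alpha$ is $u^i(\mathbf{x})=e^{ik\mathbf{x}\cdot\mathbf{d}^i}$ with $\mathbf{d}^i=(d_1^i,d_2^i)=(-\sin\alpha,\cos\alpha)$, and $u^r(\mathbf{x})=e^{ik\mathbf{x}\cdot\mathbf{d}^r}$ with $\mathbf{d}^r=(-d^i_1,d^i_2)$. The total field $u$ satisfies $(\Delta+k^2)u=0$ in $D$, $u=0$ on $\Gamma$, and $u-u^i$ satisfies the Sommerfeld radiation condition. **Fresnel functions.** ${\rm Fr}(z)=\tfrac12{\rm erfc}(e^{-i\pi/4}z)=\frac{e^{-i\pi/4}}{\sqrt\pi}\int_z^\infty e^{it^2}dt$; $E(r,\psi)=e^{-ikr\cos\psi}\,{\rm Fr}(-\sqrt{2kr}\cos(\psi/2))$; $u^d(r,\theta,\alpha)=E(r,\theta-\alpha)-E(r,\theta+\alpha)$ (a smooth function of $r>0$, $\theta\in\mathbb{R}$). On $\Gamma_{\rm nc}$, for $\tfrac\pi2<\alpha<\tfrac{3\pi}2$, $\Psi=2\,\partial u^d/\partial\mathbf{n}$. **Known decomposition (prior result, may be assumed).** On $\Gamma_{\rm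 nc}$, $\frac{\partial u}{\partial\mathbf{n}}(\mathbf{x}(s))=\Psi(\mathbf{x}(s))+v^+(L_{\rm nc}+s)e^{iks}+v^-(L_{\rm nc}-s)e^{-iks}+v(s)e^{ikr(s)}$, for functions $v^\pm$ analytic in $\mathrm{Re}\,s>0$ and $v$ analytic in a $k$-independent complex neighbourhood of $[0,L_{\rm nc}]$. **The function $g$.** For $R>0$, $0<\beta<\pi$, with principal square roots, let $$\rho(s)=\sqrt{R^2+s^2-2sR\cos\beta},\qquad \mu(s)=\frac{\sqrt k\,s\sin\beta}{\sqrt{R-s\cos\beta+\rho(s)}},\qquad F(z)=e^{-iz^2}{\rm Fr}(z),$$ $$g(s;R,\beta)=\frac{e^{3\pi i/4}}{\sqrt\pi}\,\frac{k\sin\beta\,(\rho(s)-R)}{2\rho(s)\mu(s)}-ik\sin\beta\,F(\mu(s)),$$ where the removable singularity at $s=0$ is filled in by continuity. This is used for real $s\ge0$ and, by the same formula, for complex $s$ off the branch cuts $\{R\cos\beta+iy:\ |y|\ge R\sin\beta\}$.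
   Formalization: In (a) both identities exclude the single point α = π, s = 0: there Ψ = 0 and Ψ_GO = 0, while V(0) = −2g(0) = ik ≠ 0 with H(0) = 1/2, so the stated formula fails at that point. *)

theory Defs
  imports "HOL-Complex_Analysis.Complex_Analysis"
begin

type_synonym point = "real \<times> real"

section \<open>Geometry\<close>

definition polygon_sides :: "real \<Rightarrow> real \<Rightarrow> point \<Rightarrow> point set" where
  "polygon_sides Lnc Lnc' S =
     closed_segment (0, 0) (0, -Lnc') \<union> closed_segment (0, -Lnc') (-Lnc, -Lnc') \<union>
     closed_segment (-Lnc, -Lnc') S \<union> closed_segment S (0, 0)"

text \<open>\<open>\<Omega>\<close> is the open region enclosed by the four sides.  It is not convex (the corner
  \<open>(0, -Lnc')\<close> is re-entrant), so it is not the convex hull of its vertices.\<close>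

definition scatterer :: "real \<Rightarrow> real \<Rightarrow> point \<Rightarrow> point set" where
  "scatterer Lnc Lnc' S = inside (polygon_sides Lnc Lnc' S)"

definition exterior_domain :: "real \<Rightarrow> real \<Rightarrow> point \<Rightarrow> point set" where
  "exterior_domain Lnc Lnc' S = - closure (scatterer Lnc Lnc' S)"

definition scatterer_bdry :: "real \<Rightarrow> real \<Rightarrow> point \<Rightarrow> point set" where
  "scatterer_bdry Lnc Lnc' S = frontier (scatterer Lnc Lnc' S)"

definition nc_point :: "real \<Rightarrow> real \<Rightarrow> point" where
  "nc_point Lnc' s = (-s, -Lnc')"

definition nc_normal :: point where
  "nc_normal = (0, 1)"

definition r_nc :: "real \<Rightarrow> real \<Rightarrow> real" where
  "r_nc Lnc' s = sqrt (s\<^sup>2 + Lnc'\<^sup>2)"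

section \<open>The scattering problem\<close>

definition dir_deriv :: "(point \<Rightarrow> complex) \<Rightarrow> point \<Rightarrow> point \<Rightarrow> complex" where
  "dir_deriv f d x = vector_derivative (\<lambda>t. f (x + t *\<^sub>R d)) (at 0)"

text \<open>Derivative of \<open>f\<close> at a point of \<open>\<Gamma>\<^sub>n\<^sub>c\<close> along the normal, taken from the exterior side only,
  since the total field is prescribed only on the closure of the exterior domain.\<close>

definition normal_deriv :: "(point \<Rightarrow> complex) \<Rightarrow> point \<Rightarrow> complex" where
  "normal_deriv f x = vector_derivative (\<lambda>t. f (x + t *\<^sub>R nc_normal)) (at 0 within {0..})"

definition C2_on :: "(point \<Rightarrow> complex) \<Rightarrow> point set \<Rightarrow> bool" where
  "C2_on f D \<longleftrightarrow> f differentiable_on D \<and>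
     (\<forall>b\<in>Basis. dir_deriv f b differentiable_on D \<and>
        (\<forall>c\<in>Basis. continuous_on D (dir_deriv (dir_deriv f b) c)))"

definition laplacian :: "(point \<Rightarrow> complex) \<Rightarrow> point \<Rightarrow> complex" where
  "laplacian f x = (\<Sum>b\<in>Basis. dir_deriv (dir_deriv f b) b x)"

text \<open>Sommerfeld's condition in two dimensions, uniform in the direction \<open>x / |x|\<close>.\<close>

definition sommerfeld :: "real \<Rightarrow> (point \<Rightarrow> complex) \<Rightarrow> bool" where
  "sommerfeld k w \<longleftrightarrow>
     ((\<lambda>x. of_real (sqrt (norm x)) *
            (dir_deriv w (x /\<^sub>R norm x) x - \<i> * of_real k * w x)) \<longlongrightarrow> 0) at_infinity"

definition d_inc :: "real \<Rightarrow> point" where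
  "d_inc \<alpha> = (- sin \<alpha>, cos \<alpha>)"

definition d_ref :: "real \<Rightarrow> point" where
  "d_ref \<alpha> = (- fst (d_inc \<alpha>), snd (d_inc \<alpha>))"

definition plane_wave :: "real \<Rightarrow> point \<Rightarrow> point \<Rightarrow> complex" where
  "plane_wave k d x = exp (\<i> * of_real (k * (x \<bullet> d)))"

definition u_inc :: "real \<Rightarrow> real \<Rightarrow> point \<Rightarrow> complex" where
  "u_inc k \<alpha> = plane_wave k (d_inc \<alpha>)"

definition u_ref :: "real \<Rightarrow> real \<Rightarrow> point \<Rightarrow> complex" where
  "u_ref k \<alpha> = plane_wave k (d_ref \<alpha>)"

text \<open>Classical solutions: twice continuously differentiable in the exterior domain and
  continuous up to the boundary.\<close>

definition total_field ::
  "real \<Rightarrow> real \<Rightarrow> point \<Rightarrow> real \<Rightarrow> real \<Rightarrow> (point \<Rightarrow> complex) \<Rightarrow> bool" where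
  "total_field Lnc Lnc' S k \<alpha> u \<longleftrightarrow>
     C2_on u (exterior_domain Lnc Lnc' S) \<and>
     continuous_on (closure (exterior_domain Lnc Lnc' S)) u \<and>
     (\<forall>x\<in>exterior_domain Lnc Lnc' S. laplacian u x + of_real (k\<^sup>2) * u x = 0) \<and>
     (\<forall>x\<in>scatterer_bdry Lnc Lnc' S. u x = 0) \<and>
     sommerfeld k (\<lambda>x. u x - u_inc k \<alpha> x)"

section \<open>Fresnel functions and the canonical diffraction solution\<close>

definition erf :: "complex \<Rightarrow> complex" where
  "erf z = 2 / of_real (sqrt pi) * contour_integral (linepath 0 z) (\<lambda>t. exp (- t\<^sup>2))"

definition erfc :: "complex \<Rightarrow> complex" where
  "erfc z = 1 - erf z"

definition Fr :: "complex \<Rightarrow> complex" where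
  "Fr z = erfc (exp (- \<i> * of_real pi / 4) * z) / 2"

definition E_fun :: "real \<Rightarrow> real \<Rightarrow> real \<Rightarrow> complex" where
  "E_fun k r \<psi> = exp (- \<i> * of_real (k * r * cos \<psi>)) *
     Fr (of_real (- sqrt (2 * k * r) * cos (\<psi> / 2)))"

definition u_d :: "real \<Rightarrow> real \<Rightarrow> real \<Rightarrow> real \<Rightarrow> complex" where
  "u_d k r \<theta> \<alpha> = E_fun k r (\<theta> - \<alpha>) - E_fun k r (\<theta> + \<alpha>)"

text \<open>\<open>u_d\<close> is \<open>4\<pi>\<close>-periodic but not \<open>2\<pi>\<close>-periodic in \<open>\<theta>\<close>, so the branch of the polar angle
  matters.  This branch is smooth in the half-plane \<open>x\<^sub>2 < 0\<close>, which contains \<open>\<Gamma>\<^sub>n\<^sub>c\<close>; on \<open>\<Gamma>\<^sub>n\<^sub>c\<close> it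
  equals \<open>2 * pi - arctan (s / Lnc')\<close>.\<close>

definition theta_nc :: "point \<Rightarrow> real" where
  "theta_nc x = 2 * pi - arctan (fst x / snd x)"

lemma polar_coordinates_theta_nc:
  assumes "snd x < 0"
  shows "x = norm x *\<^sub>R (sin (theta_nc x), - cos (theta_nc x))"
proof -
  obtain a b where x: "x = (a, b)" by (cases x)
  with assms have b: "b < 0" by simp
  have "1 + (a / b)\<^sup>2 = (a\<^sup>2 + b\<^sup>2) / b\<^sup>2"
    using b by (simp add: field_simps power2_eq_square)
  then have q: "sqrt (1 + (a / b)\<^sup>2) = sqrt (a\<^sup>2 + b\<^sup>2) / (- b)"
    using b by (simp add: real_sqrt_divide)
  have p: "sqrt (a\<^sup>2 + b\<^sup>2) > 0"
    using b by (simp add: add_nonneg_pos)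
  show ?thesis
    using b p unfolding x theta_nc_def
    by (simp add: norm_Pair sin_diff cos_diff sin_arctan cos_arctan q)
qed

definition u_d_cart :: "real \<Rightarrow> real \<Rightarrow> point \<Rightarrow> complex" where
  "u_d_cart k \<alpha> x = u_d k (norm x) (theta_nc x) \<alpha>"

text \<open>Functions on \<open>\<Gamma>\<^sub>n\<^sub>c\<close> are given in terms of the arc length \<open>s\<close>.\<close>

definition Psi :: "real \<Rightarrow> real \<Rightarrow> real \<Rightarrow> real \<Rightarrow> complex" where
  "Psi k Lnc' \<alpha> s = 2 * normal_deriv (u_d_cart k \<alpha>) (nc_point Lnc' s)"

section \<open>The function \<open>g\<close>\<close>

definition rho :: "real \<Rightarrow> real \<Rightarrow> complex \<Rightarrow> complex" where
  "rho R \<beta> s = csqrt (of_real (R\<^sup>2) + s\<^sup>2 - 2 * s * of_real (R * cos \<beta>))"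

definition mu :: "real \<Rightarrow> real \<Rightarrow> real \<Rightarrow> complex \<Rightarrow> complex" where
  "mu k R \<beta> s = of_real (sqrt k) * s * of_real (sin \<beta>) /
     csqrt (of_real R - s * of_real (cos \<beta>) + rho R \<beta> s)"

definition F_fun :: "complex \<Rightarrow> complex" where
  "F_fun z = exp (- \<i> * z\<^sup>2) * Fr z"

definition g_raw :: "real \<Rightarrow> real \<Rightarrow> real \<Rightarrow> complex \<Rightarrow> complex" where
  "g_raw k R \<beta> s =
     exp (3 * of_real pi * \<i> / 4) / of_real (sqrt pi) *
       (of_real (k * sin \<beta>) * (rho R \<beta> s - of_real R) / (2 * rho R \<beta> s * mu k R \<beta> s))
     - \<i> * of_real (k * sin \<beta>) * F_fun (mu k R \<beta> s)"

text \<open>The value at the removable singularity \<open>s = 0\<close> is the limit there.\<close>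

definition g :: "real \<Rightarrow> complex \<Rightarrow> real \<Rightarrow> real \<Rightarrow> complex" where
  "g k s R \<beta> = (if s = 0 then Lim (at 0) (g_raw k R \<beta>) else g_raw k R \<beta> s)"

definition g_plus :: "real \<Rightarrow> real \<Rightarrow> real \<Rightarrow> complex \<Rightarrow> complex" where
  "g_plus k Lnc' \<alpha> s = g k s (Lnc' / cos (pi - \<alpha>)) (pi / 2 + \<bar>pi - \<alpha>\<bar>)"

definition g_minus :: "real \<Rightarrow> real \<Rightarrow> real \<Rightarrow> complex \<Rightarrow> complex" where
  "g_minus k Lnc' \<alpha> s = g k s (Lnc' / cos (pi - \<alpha>)) (pi / 2 - \<bar>pi - \<alpha>\<bar>)"

text \<open>Since \<open>Arg 0 = 0\<close>, the removable singularity \<open>s = 0\<close> of \<open>g\<close> belongs to this set.\<close>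

definition S_region :: "real \<Rightarrow> real \<Rightarrow> complex set" where
  "S_region Lnc' \<delta> =
     {s. \<bar>Im s\<bar> < (1 - \<delta>) * Lnc' \<and> \<bar>Arg s\<bar> < arctan (sqrt ((11 + 5 * sqrt 5) / 2))}"

section \<open>Geometrical optics\<close>

definition heaviside :: "real \<Rightarrow> real" where
  "heaviside x = (if x < 0 then 0 else if x = 0 then 1 / 2 else 1)"

definition s_SB_i :: "real \<Rightarrow> real \<Rightarrow> real" where
  "s_SB_i Lnc' \<alpha> = Lnc' * tan (pi - \<alpha>)"

definition s_SB_r :: "real \<Rightarrow> real \<Rightarrow> real" where
  "s_SB_r Lnc' \<alpha> = Lnc' * tan (\<alpha> - pi)"

definition s_SB :: "real \<Rightarrow> real \<Rightarrow> real" where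
  "s_SB Lnc' \<alpha> = Lnc' * \<bar>tan (pi - \<alpha>)\<bar>"

definition Psi_GO :: "real \<Rightarrow> real \<Rightarrow> real \<Rightarrow> real \<Rightarrow> complex" where
  "Psi_GO k Lnc' \<alpha> s = 2 *
     (of_real (heaviside (s - s_SB_i Lnc' \<alpha>)) * normal_deriv (u_inc k \<alpha>) (nc_point Lnc' s)
      - of_real (heaviside (s_SB_r Lnc' \<alpha> - s)) * normal_deriv (u_ref k \<alpha>) (nc_point Lnc' s))"

definition V_fun :: "real \<Rightarrow> real \<Rightarrow> real \<Rightarrow> real \<Rightarrow> complex" where
  "V_fun k Lnc' \<alpha> s = 2 *
     (- of_real (heaviside (s - s_SB Lnc' \<alpha>)) * g_plus k Lnc' \<alpha> (of_real (s - s_SB Lnc' \<alpha>))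
      + of_real (heaviside (s_SB Lnc' \<alpha> - s)) * g_minus k Lnc' \<alpha> (of_real (s_SB Lnc' \<alpha> - s))
      - g_minus k Lnc' \<alpha> (of_real (s + s_SB Lnc' \<alpha>)))"

end

theory Submission
  imports Defs "HOL-Probability.Distributions"
begin

text \<open>
  On the side, with \<open>e = \<pi> - \<alpha>\<close>, \<open>\<theta> = 2 \<pi> - a\<close> and \<open>G e = exp (\<i> k r cos (e - a)) * Fr (sqrt (2 k r) sin ((e - a) / 2))\<close>,
  the reflection formula \<open>Fr (- z) = 1 - Fr z\<close> gives \<open>u\<^sup>d = G e + G (- e) - u\<^sup>r\<close>. The normal derivative of
  \<open>G e\<close> is \<open>exp (\<i> k r)\<close> times a sum of an algebraic term and a multiple of \<open>F\<close>. Since \<open>\<rho> = r\<close> and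
  \<open>\<mu>\<close> is, up to sign, the argument of \<open>Fr\<close>, it equals both \<open>exp (\<i> k r) * g (y - s)\<close> with \<open>\<beta> = \<pi> / 2 - e\<close> and, by
  reflection, the derivative of the plane wave minus \<open>exp (\<i> k r) * g (s - y)\<close> with \<open>\<beta> = \<pi> / 2 + e\<close>, where
  \<open>y = L' tan e\<close> is the shadow boundary. Using the first form in the shadow, the second in the lit
  region, and their mean on the boundary yields (a).

  For (b), \<open>F\<close> is bounded on the closed right half plane. The algebraic term is estimated
  directly, and \<open>Re \<mu> \<ge> 0\<close> holds in the sector: \<open>Re \<mu> = 0\<close> is incompatible with an inequality for a cubic whose
  extremal coefficient \<open>(11 + 5 sqrt 5) / 2\<close> determines the opening angle.
\<close>

section \<open>Fresnel functions\<close>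

text \<open>The integrand is entire, hence has a primitive \<open>G\<close> on the plane, and the
  segment integral equals \<open>G w - G 0\<close>.\<close>

lemma has_field_derivative_erf:
  "(erf has_field_derivative 2 / of_real (sqrt pi) * exp (- z\<^sup>2)) (at z)"
proof -
  have "(\<lambda>t::complex. exp (- t\<^sup>2)) holomorphic_on UNIV"
    by (intro holomorphic_intros)
  then obtain G :: "complex \<Rightarrow> complex" where G: "\<And>x. (G has_field_derivative exp (- x\<^sup>2)) (at x)"
    using holomorphic_convex_primitive'[OF convex_UNIV open_UNIV] by (metis UNIV_I)
  have "contour_integral (linepath 0 w) (\<lambda>t. exp (- t\<^sup>2)) = G w - G 0" for w
    using contour_integral_unique[OF contour_integral_primitive[of UNIV G "\<lambda>t. exp (- t\<^sup>2)" "linepath 0 w"]] G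
    by simp
  then have "erf = (\<lambda>w. 2 / of_real (sqrt pi) * (G w - G 0))"
    by (auto simp: erf_def)
  then show ?thesis
    using DERIV_cmult[OF DERIV_diff[OF G[of z] DERIV_const], of "2 / of_real (sqrt pi)" "G 0"] by simp
qed

lemma erf_0 [simp]: "erf 0 = 0"
  by (simp add: erf_def)

lemma erf_minus: "erf (- z) = - erf z"
proof -
  have "\<exists>c. \<forall>w\<in>UNIV. erf w + erf (- w) = c"
  proof (rule has_field_derivative_zero_constant)
    fix w :: complex
    have "((\<lambda>w. erf (- w)) has_field_derivative 2 / of_real (sqrt pi) * exp (- (- w)\<^sup>2) * (- 1)) (at w)"
      by (rule DERIV_chain2[OF has_field_derivative_erf]) (auto intro!: derivative_eq_intros)
    with has_field_derivative_erf[of w]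
    have "((\<lambda>w. erf w + erf (- w)) has_field_derivative
        2 / of_real (sqrt pi) * exp (- w\<^sup>2) + 2 / of_real (sqrt pi) * exp (- (- w)\<^sup>2) * (- 1)) (at w)"
      by (rule DERIV_add)
    then show "((\<lambda>w. erf w + erf (- w)) has_field_derivative 0) (at w within UNIV)"
      by simp
  qed simp
  then obtain c where c: "\<And>w. erf w + erf (- w) = c" by auto
  have "c = 0" using c[of 0] by simp
  with c[of z] show ?thesis by (simp add: eq_neg_iff_add_eq_0 add.commute)
qed

lemma has_vector_derivative_erf_of_real:
  "((\<lambda>t. erf (w + of_real t)) has_vector_derivative
      2 / of_real (sqrt pi) * exp (- (w + of_real t)\<^sup>2)) (at t within A)"
proof -
  have "((\<lambda>t. w + of_real t) has_vector_derivative 1) (at t within A)"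
    by (auto intro!: derivative_eq_intros)
  from field_vector_diff_chain_within[OF this, of erf]
    has_field_derivative_at_within[OF has_field_derivative_erf, of "w + of_real t"]
  show ?thesis by (simp add: o_def)
qed

text \<open>The real Gaussian integral over the half line fixes the limit; the fundamental theorem
  of calculus identifies its truncations with values of \<open>erf\<close>.\<close>

lemma tendsto_erf_of_real: "((\<lambda>T. erf (of_real T)) \<longlongrightarrow> 1) at_top"
proof -
  have int: "has_bochner_integral lborel (\<lambda>x::real. indicator {0..} x *\<^sub>R exp (- x\<^sup>2)) (sqrt pi / 2)"
    by (rule gaussian_moment_0)
  have "((\<lambda>T. LINT x|lborel. indicator {..T} x *\<^sub>R (indicator {0..} x *\<^sub>R exp (- x\<^sup>2)))
      \<longlongrightarrow> sqrt pi / 2) at_top"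
    using tendsto_integral_at_top[OF sets_lborel integrable.intros[OF int]]
    unfolding has_bochner_integral_integral_eq[OF int] .
  then have "((\<lambda>T. 2 / sqrt pi * (LINT x|lborel. indicator {..T} x *\<^sub>R (indicator {0..} x *\<^sub>R exp (- x\<^sup>2))))
      \<longlongrightarrow> 2 / sqrt pi * (sqrt pi / 2)) at_top"
    by (intro tendsto_intros)
  then have lim: "((\<lambda>T. complex_of_real (2 / sqrt pi * (LINT x|lborel. indicator {..T} x *\<^sub>R (indicator {0..} x *\<^sub>R exp (- x\<^sup>2)))))
      \<longlongrightarrow> 1) at_top"
    using tendsto_of_real[where 'a = complex] by fastforce
  have eq: "complex_of_real (2 / sqrt pi * (LINT x|lborel. indicator {..T} x *\<^sub>R (indicator {0..} x *\<^sub>R exp (- x\<^sup>2))))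
      = erf (of_real T)" if "T \<ge> 0" for T
  proof -
    have "(LINT x|lborel. indicator {0..T} x *\<^sub>R complex_of_real (2 / sqrt pi * exp (- x\<^sup>2)))
        = erf (of_real T) - erf (of_real 0)"
      using has_vector_derivative_erf_of_real[of 0] that
      by (intro integral_FTC_atLeastAtMost) 
         (auto intro!: continuous_intros simp flip: exp_of_real)
    moreover have "(\<lambda>x. indicator {0..T} x *\<^sub>R complex_of_real (2 / sqrt pi * exp (- x\<^sup>2))) =
       (\<lambda>x. complex_of_real (2 / sqrt pi * (indicator {..T} x *\<^sub>R (indicator {0..} x *\<^sub>R exp (- x\<^sup>2)))))"
      by (auto simp: fun_eq_iff indicator_def)
    ultimately show ?thesis
      by (simp only: integral_complex_of_real integral_mult_right_zero) simp
  qed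
  have "eventually (\<lambda>T::real. T \<ge> 0) at_top" by (rule eventually_ge_at_top)
  then show ?thesis
    by (intro Lim_transform_eventually[OF lim]) (erule eventually_mono, rule eq)
qed

text \<open>By the mean value inequality on the segment from \<open>T\<close> to
  \<open>w + T\<close>, the shift changes \<open>erf\<close> by at most a multiple of exp ((Im w)^2
  - T^2), which tends to 0. The assumption on \<open>Re w\<close> keeps the real part on the segment
  at least \<open>T\<close>.\<close>

lemma tendsto_erf_shift:
  assumes "Re w \<ge> 0"
  shows "((\<lambda>T. erf (w + of_real T)) \<longlongrightarrow> 1) at_top"
proof -
  have bnd: "norm (erf (w + of_real T) - erf (of_real T))
      \<le> 2 / sqrt pi * exp ((Im w)\<^sup>2 - T\<^sup>2) * norm w" if T: "T \<ge> 0" for T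
  proof -
    have "norm (erf (w + of_real T) - erf (of_real T)) 
        \<le> 2 / sqrt pi * exp ((Im w)\<^sup>2 - T\<^sup>2) * norm (w + of_real T - of_real T)"
    proof (rule field_differentiable_bound[where S = "closed_segment (of_real T) (w + of_real T)"])
      fix z assume "z \<in> closed_segment (complex_of_real T) (w + of_real T)"
      then obtain u where u: "0 \<le> u" "u \<le> 1" and z: "z = of_real T + of_real u * w"
        by (auto simp: in_segment scaleR_conv_of_real algebra_simps)
      show "(erf has_field_derivative 2 / of_real (sqrt pi) * exp (- z\<^sup>2))
          (at z within closed_segment (of_real T) (w + of_real T))"
        by (rule has_field_derivative_at_within[OF has_field_derivative_erf])
      have "(u * Im w)\<^sup>2 \<le> (Im w)\<^sup>2"
        using u by (simp add: power_mult_distrib mult_left_le_one_le power_le_one)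
      moreover have "T\<^sup>2 \<le> (T + u * Re w)\<^sup>2"
        using u T assms by (intro power_mono) auto
      ultimately have "(Im z)\<^sup>2 - (Re z)\<^sup>2 \<le> (Im w)\<^sup>2 - T\<^sup>2"
        by (simp add: z)
      then show "norm (2 / of_real (sqrt pi) * exp (- z\<^sup>2)) \<le> 2 / sqrt pi * exp ((Im w)\<^sup>2 - T\<^sup>2)"
        by (simp add: norm_mult norm_divide norm_exp_eq_Re power2_eq_square divide_right_mono)
    qed auto
    then show ?thesis by simp
  qed
  have "((\<lambda>T::real. exp ((Im w)\<^sup>2 - T\<^sup>2)) \<longlongrightarrow> 0) at_top"
    by real_asymp
  then have z: "((\<lambda>T::real. 2 / sqrt pi * exp ((Im w)\<^sup>2 - T\<^sup>2) * norm w) \<longlongrightarrow> 2 / sqrt pi * 0 * norm w) at_top"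
    by (intro tendsto_intros)
  have "((\<lambda>T. erf (w + of_real T) - erf (of_real T)) \<longlongrightarrow> 0) at_top"
    by (rule Lim_null_comparison[OF _ z[simplified]])
       (use bnd in \<open>auto intro: eventually_mono[OF eventually_ge_at_top[of 0]]\<close>)
  from tendsto_add[OF this tendsto_erf_of_real] show ?thesis by simp
qed

text \<open>The substitution \<open>t \<mapsto> w + t\<close> turns \<open>exp (w\<^sup>2) * erfc w\<close> into the integral of \<open>exp (- 2 * w * t - t\<^sup>2)\<close>
  over the half line, which is dominated by the case \<open>w = 0\<close>.\<close>

lemma norm_exp_erfc_le:
  assumes "Re w \<ge> 0"
  shows "norm (exp (w\<^sup>2) * erfc w) \<le> 1"
proof -
  have bnd: "norm (exp (w\<^sup>2) * erf (w + of_real T) - exp (w\<^sup>2) * erf w) \<le> Re (erf (of_real T))" if T: "T > 0" for T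
  proof -
    let ?h = "\<lambda>T. exp (w\<^sup>2) * erf (w + of_real T)" and ?p = "\<lambda>T. Re (erf (0 + of_real T))"
    let ?h' = "\<lambda>t. exp (w\<^sup>2) * (2 / of_real (sqrt pi) * exp (- (w + of_real t)\<^sup>2))"
    let ?p' = "\<lambda>t. Re (2 / of_real (sqrt pi) * exp (- (0 + of_real t)\<^sup>2))"
    have h: "(?h has_vector_derivative ?h' t) (at t)" for t
      by (intro has_vector_derivative_mult_right has_vector_derivative_erf_of_real)
    have p: "(?p has_vector_derivative ?p' t) (at t)" for t
      by (intro has_vector_derivative_erf_of_real bounded_linear.has_vector_derivative[OF bounded_linear_Re])
    have "norm (?h T - ?h 0) \<le> ?p T - ?p 0"
    proof (rule differentiable_bound_general[OF T _ _ h p])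
      show "continuous_on {0..T} ?h" "continuous_on {0..T} ?p"
        using has_vector_derivative_continuous[OF h] has_vector_derivative_continuous[OF p]
        by (auto intro!: continuous_at_imp_continuous_on)
      fix x :: real assume x: "0 < x"
      have "?h' x = 2 / of_real (sqrt pi) * exp (- 2 * w * of_real x - of_real (x\<^sup>2))"
      proof -
        have "?h' x = 2 / of_real (sqrt pi) * exp (w\<^sup>2 + - (w + of_real x)\<^sup>2)"
          unfolding exp_add by (simp add: mult_ac)
        also have "w\<^sup>2 + - (w + of_real x)\<^sup>2 = - 2 * w * of_real x - of_real (x\<^sup>2)"
          by (simp add: power2_eq_square algebra_simps)
        finally show ?thesis .
      qed
      moreover have "norm (2 / of_real (sqrt pi) * exp (- 2 * w * of_real x - of_real (x\<^sup>2)))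
          = 2 / sqrt pi * exp (- 2 * Re w * x - x\<^sup>2)"
        by (simp add: norm_mult norm_divide)
      ultimately have "norm (?h' x) = 2 / sqrt pi * exp (- 2 * Re w * x - x\<^sup>2)"
        by (simp only:)
      also have "\<dots> \<le> 2 / sqrt pi * exp (- x\<^sup>2)"
        using x assms by (intro mult_left_mono) auto
      also have "\<dots> = ?p' x"
      proof -
        have "2 / of_real (sqrt pi) * exp (- (0 + of_real x)\<^sup>2) = complex_of_real (2 / sqrt pi * exp (- x\<^sup>2))"
          by (simp flip: exp_of_real)
        then show ?thesis by (simp only: Re_complex_of_real)
      qed
      finally show "norm (?h' x) \<le> ?p' x" .
    qed
    then show ?thesis by simp
  qed
  have "((\<lambda>T. Re (erf (of_real T))) \<longlongrightarrow> Re 1) at_top"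
    by (intro tendsto_intros tendsto_erf_of_real)
  moreover have "((\<lambda>T. norm (exp (w\<^sup>2) * erf (w + of_real T) - exp (w\<^sup>2) * erf w)) \<longlongrightarrow>
      norm (exp (w\<^sup>2) * 1 - exp (w\<^sup>2) * erf w)) at_top"
    by (intro tendsto_intros tendsto_erf_shift assms)
  ultimately have "norm (exp (w\<^sup>2) * 1 - exp (w\<^sup>2) * erf w) \<le> Re 1"
    by (rule tendsto_le[OF trivial_limit_at_top_linorder])
       (use bnd in \<open>auto intro: eventually_mono[OF eventually_gt_at_top[of 0]]\<close>)
  then show ?thesis by (simp add: erfc_def algebra_simps)
qed

section \<open>The Fresnel integral \<open>Fr\<close> and the bounded combination
  \<open>F_fun\<close>\<close>

lemma exp_minus_i_pi_4_squared: "(exp (- \<i> * of_real pi / 4))\<^sup>2 = - \<i>"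
proof -
  have "(exp (- \<i> * of_real pi / 4))\<^sup>2 = cis (- (pi / 2))"
    by (simp add: power2_eq_square cis_conv_exp flip: exp_add)
  then show ?thesis by (simp add: complex_eq_iff)
qed

lemma has_field_derivative_Fr:
  "(Fr has_field_derivative - exp (- \<i> * of_real pi / 4) / of_real (sqrt pi) * exp (\<i> * z\<^sup>2)) (at z)"
proof -
  let ?c = "exp (- \<i> * of_real pi / 4)"
  have "((\<lambda>z. erf (?c * z)) has_field_derivative
      2 / of_real (sqrt pi) * exp (- (?c * z)\<^sup>2) * ?c) (at z)"
    by (rule DERIV_chain2[OF has_field_derivative_erf]) (auto intro!: derivative_eq_intros)
  then have "(Fr has_field_derivative (0 - 2 / of_real (sqrt pi) * exp (- (?c * z)\<^sup>2) * ?c) / 2) (at z)"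
    unfolding Fr_def[abs_def] erfc_def by (intro DERIV_cdivide DERIV_diff DERIV_const)
  then show ?thesis
    unfolding power_mult_distrib exp_minus_i_pi_4_squared by (simp add: mult_ac)
qed

lemma Fr_minus: "Fr (- z) = 1 - Fr z"
  by (simp add: Fr_def erfc_def erf_minus field_simps)

lemma F_fun_minus: "F_fun (- z) = exp (- \<i> * z\<^sup>2) - F_fun z"
  by (simp add: F_fun_def Fr_minus algebra_simps)

lemma F_fun_holomorphic_on_UNIV: "F_fun holomorphic_on UNIV"
proof -
  have "Fr holomorphic_on UNIV"
    by (metis has_field_derivative_Fr field_differentiable_def field_differentiable_at_within holomorphic_onI)
  then show ?thesis
    unfolding F_fun_def[abs_def] by (intro holomorphic_intros)
qed

text \<open>With \<open>w = exp (- \<i> \<pi> / 4) z\<close> one has \<open>F z = exp (w\<^sup>2) * erfc w / 2\<close>. The half plane \<open>Re z \<ge> 0\<close>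
  is mapped to \<open>Re w \<ge> Im w\<close>; where \<open>Re w < 0\<close>, the Gaussian \<open>exp (w\<^sup>2)\<close> is bounded and reflection
  in the origin applies.\<close>

lemma norm_F_fun_le:
  assumes "Re z \<ge> 0"
  shows "norm (F_fun z) \<le> 3 / 2"
proof -
  define w where "w = exp (- \<i> * of_real pi / 4) * z"
  have c: "exp (- \<i> * of_real pi / 4) = of_real (sqrt 2 / 2) * (1 - \<i>)"
    by (simp add: complex_eq_iff Re_exp Im_exp cos_45 sin_45)
  have w: "w = of_real (sqrt 2 / 2) * ((1 - \<i>) * z)"
    unfolding w_def c by simp
  have w2: "w\<^sup>2 = - \<i> * z\<^sup>2"
    unfolding w_def power_mult_distrib exp_minus_i_pi_4_squared ..
  have F: "F_fun z = exp (w\<^sup>2) * erfc w / 2"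
    unfolding F_fun_def Fr_def w2 unfolding w_def by (simp only: times_divide_eq_right)
  show ?thesis
  proof (cases "Re w \<ge> 0")
    case True
    then show ?thesis using norm_exp_erfc_le[of w] by (simp add: F norm_divide)
  next
    case False
    have "Re w = sqrt 2 / 2 * (Re z + Im z)" "Im w = sqrt 2 / 2 * (Im z - Re z)"
      by (simp_all add: w algebra_simps)
    then have "Re w - Im w = sqrt 2 * Re z" by (simp add: algebra_simps)
    then have "Re w - Im w \<ge> 0" using assms by simp
    with False have "\<bar>Re w\<bar> \<le> \<bar>Im w\<bar>" by auto
    then have "Re (w\<^sup>2) \<le> 0"
      by (simp add: Re_power2 abs_le_square_iff)
    then have e: "norm (exp (w\<^sup>2)) \<le> 1" by simp
    have "exp (w\<^sup>2) * erfc w = 2 * exp (w\<^sup>2) - exp ((- w)\<^sup>2) * erfc (- w)"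
      by (simp add: erfc_def erf_minus algebra_simps)
    then have "norm (exp (w\<^sup>2) * erfc w) \<le> norm (2 * exp (w\<^sup>2)) + norm (exp ((- w)\<^sup>2) * erfc (- w))"
      by (metis norm_triangle_ineq4)
    also have "\<dots> \<le> 2 * 1 + 1"
      using False e by (intro add_mono norm_exp_erfc_le) (auto simp: norm_mult)
    finally show ?thesis by (simp add: F norm_divide)
  qed
qed

section \<open>The function \<open>g\<close> in the strip\<close>

text \<open>A principal root has nonnegative real part; were this 0, the square would be a
  nonpositive real.\<close>

lemma Re_csqrt_pos:
  assumes "z \<notin> \<real>\<^sub>\<le>\<^sub>0"
  shows "Re (csqrt z) > 0"
proof (rule ccontr)
  assume "\<not> Re (csqrt z) > 0"
  then have "Re (csqrt z) = 0"
    using csqrt_principal[of z] by auto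
  then have "Re ((csqrt z)\<^sup>2) \<le> 0" "Im ((csqrt z)\<^sup>2) = 0"
    by (simp_all add: Re_power2 Im_power2 del: csqrt.sel power2_csqrt)
  with assms show False
    by (auto simp: complex_nonpos_Reals_iff)
qed

definition q_fun :: "real \<Rightarrow> real \<Rightarrow> complex \<Rightarrow> complex" where
  "q_fun R \<beta> s = of_real R - s * of_real (cos \<beta>) + rho R \<beta> s"

text \<open>In the first term of \<open>g\<close> the factor \<open>s\<close> cancels because \<open>\<rho>\<^sup>2 - R\<^sup>2 = s (s - 2 R cos \<beta>)\<close>; this form
  is regular at \<open>s = 0\<close>.\<close>

definition g_reg :: "real \<Rightarrow> real \<Rightarrow> real \<Rightarrow> complex \<Rightarrow> complex" where
  "g_reg k R \<beta> s =
     exp (3 * of_real pi * \<i> / 4) / of_real (sqrt pi) *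
       (of_real (sqrt k) * (s - of_real (2 * R * cos \<beta>)) * csqrt (q_fun R \<beta> s) /
         (2 * rho R \<beta> s * (rho R \<beta> s + of_real R)))
     - \<i> * of_real (k * sin \<beta>) * F_fun (mu k R \<beta> s)"

lemma mu_eq: "mu k R \<beta> s = of_real (sqrt k * sin \<beta>) * s / csqrt (q_fun R \<beta> s)"
  by (simp add: mu_def q_fun_def mult_ac)

text \<open>Completing the square exhibits the branch points, R cos \<beta> plus or minus i R sin
  \<beta>.\<close>

lemma rho_power2: "(rho R \<beta> s)\<^sup>2 = (s - of_real (R * cos \<beta>))\<^sup>2 + of_real ((R * sin \<beta>)\<^sup>2)"
proof -
  have "(R * sin \<beta>)\<^sup>2 = R\<^sup>2 - (R * cos \<beta>)\<^sup>2"
    by (simp add: power_mult_distrib sin_squared_eq algebra_simps)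
  then have eq: "complex_of_real ((R * sin \<beta>)\<^sup>2) = of_real (R\<^sup>2) - (of_real (R * cos \<beta>))\<^sup>2"
    by simp
  show ?thesis
    unfolding eq rho_def power2_csqrt by (simp add: power2_eq_square algebra_simps)
qed

section \<open>Analyticity in the strip between the branch points\<close>

locale strip =
  fixes R \<beta> :: real
  assumes R: "0 < R" and \<beta>: "0 < \<beta>" "\<beta> < pi"
begin

text \<open>The widest symmetric horizontal strip that avoids the branch cuts of \<open>rho\<close>.
  For \<open>g_plus\<close> and \<open>g_minus\<close> its half-width \<open>R * sin \<beta>\<close>
  is \<open>Lnc'\<close>.\<close>

definition "strip_set = {s. \<bar>Im s\<bar> < R * sin \<beta>}"

lemma sin_pos: "0 < sin \<beta>"
  using \<beta> by (rule sin_gt_zero)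

lemma cos2_less_1: "(cos \<beta>)\<^sup>2 < 1"
proof -
  have "(sin \<beta>)\<^sup>2 > 0" using sin_pos by simp
  then show ?thesis using sin_cos_squared_add[of \<beta>] by linarith
qed

lemma open_strip_set: "open strip_set"
  unfolding strip_set_def by (intro open_Collect_less continuous_intros)

text \<open>Inside the strip the completed square has real part larger than x^2, since y^2 < (R sin
  \<beta>)^2.\<close>

lemma rho_radicand_notin:
  assumes "s \<in> strip_set"
  shows "of_real (R\<^sup>2) + s\<^sup>2 - 2 * s * of_real (R * cos \<beta>) \<notin> \<real>\<^sub>\<le>\<^sub>0"
proof
  define x y where "x = Re s - R * cos \<beta>" and "y = Im s"
  assume "of_real (R\<^sup>2) + s\<^sup>2 - 2 * s * of_real (R * cos \<beta>) \<in> \<real>\<^sub>\<le>\<^sub>0"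
  then have "(s - of_real (R * cos \<beta>))\<^sup>2 + of_real ((R * sin \<beta>)\<^sup>2) \<in> \<real>\<^sub>\<le>\<^sub>0"
    using rho_power2[of R \<beta> s] by (simp add: rho_def)
  then have re: "x\<^sup>2 - y\<^sup>2 + (R * sin \<beta>)\<^sup>2 \<le> 0" and im: "x * y = 0"
    by (auto simp: complex_nonpos_Reals_iff Re_power2 Im_power2 x_def y_def)
  have "y\<^sup>2 < (R * sin \<beta>)\<^sup>2"
    using assms abs_le_square_iff[of "R * sin \<beta>" y] R sin_pos
    by (simp add: strip_set_def y_def not_le[symmetric])
  with re im show False
    by (smt (verit) zero_le_power2)
qed

lemma Re_rho_pos: "s \<in> strip_set \<Longrightarrow> Re (rho R \<beta> s) > 0"
  unfolding rho_def by (intro Re_csqrt_pos rho_radicand_notin)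

lemma rho_nz [simp]: "s \<in> strip_set \<Longrightarrow> rho R \<beta> s \<noteq> 0"
  using Re_rho_pos by fastforce

lemma rho_add_R_nz [simp]: "s \<in> strip_set \<Longrightarrow> rho R \<beta> s + of_real R \<noteq> 0"
  using Re_rho_pos[of s] R by (auto simp: complex_eq_iff)

lemma rho_parts:
  fixes s defines "x \<equiv> Re s" and "y \<equiv> Im s" and "a \<equiv> Re (rho R \<beta> s)" and "b \<equiv> Im (rho R \<beta> s)"
  shows "a\<^sup>2 - b\<^sup>2 = R\<^sup>2 + x\<^sup>2 - y\<^sup>2 - 2 * R * x * cos \<beta>" "a * b = x * y - R * y * cos \<beta>"
proof -
  have eq: "(rho R \<beta> s)\<^sup>2 = of_real (R\<^sup>2) + s\<^sup>2 - 2 * s * of_real (R * cos \<beta>)"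
    by (simp add: rho_def)
  from arg_cong[OF eq, of Re] show "a\<^sup>2 - b\<^sup>2 = R\<^sup>2 + x\<^sup>2 - y\<^sup>2 - 2 * R * x * cos \<beta>"
    by (simp add: Re_power2 a_def b_def x_def y_def)
  from arg_cong[OF eq, of Im] show "a * b = x * y - R * y * cos \<beta>"
    by (simp add: Im_power2 a_def b_def x_def y_def algebra_simps)
qed

text \<open>A nonpositive real value would force \<open>b = y * c\<close> and
  \<open>R - x * c + a \<le> 0\<close>. On the real axis, comparison with the square of
  \<open>rho\<close> leaves only x = 0; off it, \<open>x = (a + R) * c\<close>. Both contradict the
  positivity of \<open>a\<close> and \<open>R\<close>.\<close>

lemma q_fun_notin:
  assumes s: "s \<in> strip_set"
  shows "q_fun R \<beta> s \<notin> \<real>\<^sub>\<le>\<^sub>0"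
proof
  define x y a b c where "x = Re s" and "y = Im s" and "a = Re (rho R \<beta> s)" and "b = Im (rho R \<beta> s)"
    and "c = cos \<beta>"
  have a: "a > 0" using Re_rho_pos[OF s] by (simp add: a_def)
  have c: "c\<^sup>2 < 1" using cos2_less_1 by (simp add: c_def)
  assume "q_fun R \<beta> s \<in> \<real>\<^sub>\<le>\<^sub>0"
  then have b: "b = y * c" and re: "R - x * c + a \<le> 0"
    by (auto simp: q_fun_def complex_nonpos_Reals_iff a_def b_def x_def y_def c_def)
  have sq: "a\<^sup>2 - b\<^sup>2 = R\<^sup>2 + x\<^sup>2 - y\<^sup>2 - 2 * R * x * c" and ab: "a * b = x * y - R * y * c"
    using rho_parts[of s] by (simp_all add: x_def y_def a_def b_def c_def)
  show False
  proof (cases "y = 0")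
    case True
    have "a\<^sup>2 \<le> (x * c - R)\<^sup>2"
      using a re by (intro power_mono) auto
    with sq b True have "x\<^sup>2 * (1 - c\<^sup>2) \<le> 0"
      by (simp add: power2_eq_square algebra_simps)
    with c have "x = 0"
      by (simp add: mult_le_0_iff)
    with re a R show False by simp
  next
    case False
    have "y * (a * c - (x - R * c)) = 0"
      using ab b by (simp add: algebra_simps)
    with False have "a * c - (x - R * c) = 0" by (metis mult_eq_0_iff)
    then have "x = (a + R) * c" by (simp add: algebra_simps)
    with re have "(a + R) * (1 - c\<^sup>2) \<le> 0"
      by (simp add: power2_eq_square algebra_simps)
    with c a R show False by (simp add: mult_le_0_iff)
  qed
qed

lemma q_fun_nz [simp]: "s \<in> strip_set \<Longrightarrow> q_fun R \<beta> s \<noteq> 0"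
  using q_fun_notin by fastforce

lemma rho_holomorphic_on: "rho R \<beta> holomorphic_on strip_set"
  unfolding rho_def[abs_def] by (intro holomorphic_intros rho_radicand_notin)

lemma q_fun_holomorphic_on: "q_fun R \<beta> holomorphic_on strip_set"
  unfolding q_fun_def[abs_def] by (intro holomorphic_intros rho_holomorphic_on)

lemma mu_holomorphic_on: "mu k R \<beta> holomorphic_on strip_set"
  unfolding mu_eq[abs_def] by (intro holomorphic_intros q_fun_holomorphic_on q_fun_notin) simp_all

lemma g_reg_holomorphic_on: "g_reg k R \<beta> holomorphic_on strip_set"
proof -
  have "(\<lambda>s. F_fun (mu k R \<beta> s)) holomorphic_on strip_set"
    using holomorphic_on_compose_gen[OF mu_holomorphic_on F_fun_holomorphic_on_UNIV, of k]
    by (simp add: o_def)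
  then show ?thesis
    unfolding g_reg_def[abs_def]
    by (intro holomorphic_intros q_fun_holomorphic_on rho_holomorphic_on q_fun_notin) simp_all
qed

lemma g_raw_eq_g_reg:
  assumes k: "0 < k" and s: "s \<in> strip_set" "s \<noteq> 0"
  shows "g_raw k R \<beta> s = g_reg k R \<beta> s"
proof -
  define w \<rho> where "w = csqrt (q_fun R \<beta> s)" and "\<rho> = rho R \<beta> s"
  have nz: "w \<noteq> 0" "\<rho> \<noteq> 0" "\<rho> + of_real R \<noteq> 0"
    using s(1) by (simp_all add: w_def \<rho>_def)
  have sq: "(\<rho> - of_real R) * (\<rho> + of_real R) = s * (s - of_real (2 * R * cos \<beta>))"
  proof -
    have "(\<rho> - of_real R) * (\<rho> + of_real R) = \<rho>\<^sup>2 - of_real (R\<^sup>2)"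
      by (simp add: power2_eq_square algebra_simps)
    also have "\<rho>\<^sup>2 - of_real (R\<^sup>2) = s * (s - of_real (2 * R * cos \<beta>))"
      unfolding \<rho>_def rho_def power2_csqrt by (simp add: power2_eq_square algebra_simps)
    finally show ?thesis .
  qed
  have "of_real (k * sin \<beta>) * (\<rho> - of_real R) / (2 * \<rho> * mu k R \<beta> s) =
      of_real (sqrt k) * (\<rho> - of_real R) * w / (2 * \<rho> * s)"
  proof -
    define \<kappa> \<sigma> where "\<kappa> = complex_of_real (sqrt k)" and "\<sigma> = complex_of_real (sin \<beta>)"
    have "complex_of_real (k * sin \<beta>) = of_real (sqrt k * sqrt k * sin \<beta>)"
      using k by simp
    then have k\<sigma>: "complex_of_real (k * sin \<beta>) = \<kappa> * \<kappa> * \<sigma>"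
      by (simp only: of_real_mult \<kappa>_def \<sigma>_def)
    have m: "mu k R \<beta> s = \<kappa> * \<sigma> * s / w"
      by (simp add: mu_eq w_def \<kappa>_def \<sigma>_def)
    have "\<kappa> \<noteq> 0" "\<sigma> \<noteq> 0"
      using k sin_pos by (simp_all add: \<kappa>_def \<sigma>_def)
    then show ?thesis
      unfolding k\<sigma> m \<kappa>_def[symmetric] using nz s(2) by (simp add: field_simps)
  qed
  also have "\<dots> = of_real (sqrt k) * ((\<rho> - of_real R) * (\<rho> + of_real R)) * w / (2 * \<rho> * s * (\<rho> + of_real R))"
    using nz by (simp add: mult.assoc)
  also have "\<dots> = of_real (sqrt k) * (s - of_real (2 * R * cos \<beta>)) * w / (2 * \<rho> * (\<rho> + of_real R))"
    unfolding sq using s(2) by (simp add: mult.assoc)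
  finally show ?thesis
    by (simp only: g_raw_def g_reg_def w_def \<rho>_def)
qed

lemma zero_in_strip_set: "0 \<in> strip_set"
  using R sin_pos by (simp add: strip_set_def)

text \<open>At 0 the value of \<open>g\<close> is a limit of \<open>g_raw\<close>; it exists because
  \<open>g_reg\<close> is continuous there and agrees with \<open>g_raw\<close> on the punctured
  strip.\<close>

lemma g_eq_g_reg:
  assumes k: "0 < k" and s: "s \<in> strip_set"
  shows "g k s R \<beta> = g_reg k R \<beta> s"
proof (cases "s = 0")
  case False
  with assms show ?thesis by (simp add: g_def g_raw_eq_g_reg)
next
  case True
  have "isCont (g_reg k R \<beta>) 0"
    using g_reg_holomorphic_on open_strip_set zero_in_strip_set
    by (meson continuous_on_eq_continuous_at holomorphic_on_imp_continuous_on)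
  then have "(g_reg k R \<beta> \<longlongrightarrow> g_reg k R \<beta> 0) (at 0)"
    by (simp add: isCont_def)
  moreover have "eventually (\<lambda>s. g_reg k R \<beta> s = g_raw k R \<beta> s) (at 0)"
    using open_strip_set zero_in_strip_set k
    by (auto simp: eventually_at_topological g_raw_eq_g_reg intro!: exI[of _ strip_set])
  ultimately have "(g_raw k R \<beta> \<longlongrightarrow> g_reg k R \<beta> 0) (at 0)"
    by (rule Lim_transform_eventually)
  then have "Lim (at 0) (g_raw k R \<beta>) = g_reg k R \<beta> 0"
    by (intro tendsto_Lim) simp_all
  with True show ?thesis by (simp add: g_def)
qed

text \<open>The product of \<rho> - R + s cos \<beta> and \<open>q_fun\<close> is a difference of
  squares and equals s^2 (sin \<beta>)^2. The resulting formula is free of the outer root, so signs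
  can be read off from \<open>rho\<close>.\<close>

lemma mu_power2:
  assumes k: "0 \<le> k" and s: "s \<in> strip_set"
  shows "(mu k R \<beta> s)\<^sup>2 = of_real k * (rho R \<beta> s - of_real R + s * of_real (cos \<beta>))"
proof -
  have eq: "of_real ((sin \<beta>)\<^sup>2) * s\<^sup>2 = (rho R \<beta> s - of_real R + s * of_real (cos \<beta>)) * q_fun R \<beta> s"
  proof -
    have "(rho R \<beta> s - of_real R + s * of_real (cos \<beta>)) * q_fun R \<beta> s
        = (rho R \<beta> s)\<^sup>2 - (of_real R - s * of_real (cos \<beta>))\<^sup>2"
      by (simp add: q_fun_def power2_eq_square algebra_simps)
    also have "\<dots> = s\<^sup>2 * of_real (1 - (cos \<beta>)\<^sup>2)"
      unfolding rho_def power2_csqrt by (simp add: power2_eq_square algebra_simps)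
    finally show ?thesis by (simp add: sin_squared_eq)
  qed
  have "(mu k R \<beta> s)\<^sup>2 = of_real k * (of_real ((sin \<beta>)\<^sup>2) * s\<^sup>2 / q_fun R \<beta> s)"
    using k by (simp add: mu_eq power_divide power_mult_distrib flip: of_real_power)
  then show ?thesis
    unfolding eq using s by simp
qed

end

text \<open>With \<open>w = sqrt 5\<close> the cubic equals \<open>K (c - (w - 1) / 2)\<^sup>2 (c + w - 2)\<close>: \<open>K\<close> is the largest constant for
  which it is nonnegative.\<close>

lemma golden_cubic_nonneg:
  fixes c :: real
  assumes "0 \<le> c"
  defines "K \<equiv> (11 + 5 * sqrt 5) / 2"
  shows "0 \<le> 1 + c - K * c\<^sup>2 + K * c ^ 3"
proof -
  define w :: real where "w = sqrt 5"
  have w: "w * w = 5" by (simp add: w_def)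
  then have w': "w * (w * x) = 5 * x" for x by (simp flip: mult.assoc)
  have "2 \<le> w" unfolding w_def by (rule real_le_rsqrt) simp
  then have "0 \<le> K * (c - (w - 1) / 2)\<^sup>2 * (c + w - 2)"
    using assms by (intro mult_nonneg_nonneg) (auto simp: w_def)
  also have "\<dots> = 1 + c - K * c\<^sup>2 + K * c ^ 3"
    unfolding K_def w_def[symmetric]
    by (simp add: power2_eq_square power3_eq_cube field_simps w w')
  finally show ?thesis .
qed

section \<open>Positivity of the real part of \<open>mu\<close> in the sector\<close>

context strip
begin

text \<open>If \<open>\<mu>\<close> is imaginary then \<open>\<mu>\<^sup>2 / k = \<rho> - R + s cos \<beta>\<close> is negative. With \<open>a = Re \<rho>\<close> this forces
  \<open>Re s = (R - a) cos \<beta>\<close> and \<open>(Im s)\<^sup>2 = R\<^sup>2 - a\<^sup>2\<close>; the strip condition then reads \<open>R cos \<beta> < a\<close> and the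
  sector condition contradicts the cubic inequality.\<close>

lemma Re_mu_nonzero:
  assumes k: "0 < k" and s: "s \<in> strip_set" "0 < Re s"
    and sector: "(Im s)\<^sup>2 < (11 + 5 * sqrt 5) / 2 * (Re s)\<^sup>2"
  shows "Re (mu k R \<beta> s) \<noteq> 0"
proof
  define x y a b c K where "x = Re s" and "y = Im s" and "a = Re (rho R \<beta> s)" and "b = Im (rho R \<beta> s)"
    and "c = cos \<beta>" and "K = (11 + 5 * sqrt 5) / 2"
  have K: "K > 0" by (simp add: K_def add_pos_nonneg)
  have a: "a > 0" using Re_rho_pos[OF s(1)] by (simp add: a_def)
  have c: "c\<^sup>2 < 1" using cos2_less_1 by (simp add: c_def)
  have x: "x > 0" using s by (simp add: x_def)
  assume re0: "Re (mu k R \<beta> s) = 0"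
  have "s \<noteq> 0" using s by auto
  with k s(1) sin_pos have "mu k R \<beta> s \<noteq> 0"
    by (simp add: mu_eq)
  with re0 have "Re ((mu k R \<beta> s)\<^sup>2) < 0" "Im ((mu k R \<beta> s)\<^sup>2) = 0"
    by (simp_all add: complex_eq_iff Re_power2 Im_power2)
  then have b: "b = - y * c" and re: "a - R + x * c < 0"
    using k s(1) by (auto simp: mu_power2 mult_less_0_iff a_def b_def x_def y_def c_def)
  have sq: "a\<^sup>2 - b\<^sup>2 = R\<^sup>2 + x\<^sup>2 - y\<^sup>2 - 2 * R * x * c" and ab: "a * b = x * y - R * y * c"
    using rho_parts[of s] by (simp_all add: x_def y_def a_def b_def c_def)
  show False
  proof (cases "y = 0")
    case True
    have "a\<^sup>2 < (R - x * c)\<^sup>2"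
      using a re by (intro power_strict_mono) auto
    with sq b True have "x\<^sup>2 * (1 - c\<^sup>2) < 0"
      by (simp add: power2_eq_square algebra_simps)
    with c show False by (simp add: mult_less_0_iff)
  next
    case False
    have "y * (a * c + (x - R * c)) = 0"
      using ab b by (simp add: algebra_simps)
    with False have "a * c + (x - R * c) = 0" by (metis mult_eq_0_iff)
    then have xe: "x = (R - a) * c" by (simp add: algebra_simps)
    have "(a - R) * (1 - c\<^sup>2) < 0"
      using re xe by (simp add: power2_eq_square algebra_simps)
    with c have aR: "a < R" by (simp add: mult_less_0_iff)
    with x xe have c0: "c > 0" by (simp add: zero_less_mult_iff)
    \<comment> \<open>Inserting \<open>b\<close> and \<open>x\<close> into the first equation for
      the square of \<open>rho\<close> leaves the common factor 1 - c^2.\<close>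
    have "(1 - c\<^sup>2) * (y\<^sup>2 - (R\<^sup>2 - a\<^sup>2)) = 0"
      using sq b xe by algebra
    with c have y: "y\<^sup>2 = R\<^sup>2 - a\<^sup>2" by auto
    have "y\<^sup>2 < (R * sin \<beta>)\<^sup>2"
      using s(1) abs_le_square_iff[of "R * sin \<beta>" y] R sin_pos
      by (simp add: strip_set_def y_def not_le[symmetric])
    then have "R\<^sup>2 - a\<^sup>2 < R\<^sup>2 - (R * c)\<^sup>2"
      by (simp add: y power_mult_distrib sin_squared_eq c_def algebra_simps)
    then have ac: "R * c < a"
      using a by (intro power2_less_imp_less[of "R * c" a]) auto
    \<comment> \<open>This is the sector condition with x and y expressed through \<open>a\<close>;
      one factor \<open>R - a\<close> then cancels.\<close>
    have "(R - a) * (R + a) < (R - a) * (K * (R - a) * c\<^sup>2)"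
      using sector y xe by (simp add: x_def[symmetric] y_def[symmetric] K_def[symmetric] power2_eq_square algebra_simps)
    with aR have "R + a < K * (R - a) * c\<^sup>2" by simp
    \<comment> \<open>Replacing \<open>a\<close> by the smaller \<open>R * c\<close> lowers the left
      side and raises the right side, which reduces the claim to the cubic in c.\<close>
    also have "\<dots> \<le> K * (R - R * c) * c\<^sup>2"
      using ac K by (intro mult_right_mono mult_left_mono) auto
    finally have "R * (1 + c) < R * (K * (1 - c) * c\<^sup>2)"
      using ac by (simp add: algebra_simps)
    then have "1 + c < K * (1 - c) * c\<^sup>2" using R by simp
    with golden_cubic_nonneg[of c] c0 show False
      by (simp add: K_def[symmetric] power2_eq_square power3_eq_cube algebra_simps)
  qed
qed

text \<open>On the real axis \<open>Re \<mu> > 0\<close>, and it cannot vanish on the vertical segment up to \<open>s\<close>.\<close>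

lemma Re_mu_pos:
  assumes k: "0 < k" and s: "s \<in> strip_set" "0 < Re s"
    and sector: "(Im s)\<^sup>2 < (11 + 5 * sqrt 5) / 2 * (Re s)\<^sup>2"
  shows "Re (mu k R \<beta> s) > 0"
proof (rule ccontr)
  assume neg: "\<not> Re (mu k R \<beta> s) > 0"
  define z where "z = (\<lambda>t. Complex (Re s) (t * Im s))"
  have z: "z t \<in> strip_set" if "t \<in> {0..1}" for t
    using that s(1) mult_left_le_one_le[of "\<bar>Im s\<bar>" t] by (auto simp: z_def strip_set_def abs_mult)
  have "continuous_on {0..1} z"
    unfolding z_def Complex_eq by (intro continuous_intros)
  then have cont: "continuous_on {0..1} (\<lambda>t. Re (mu k R \<beta> (z t)))"
    using holomorphic_on_imp_continuous_on[OF mu_holomorphic_on] z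
    by (intro continuous_on_Re continuous_on_compose2[where f = z and g = "mu k R \<beta>"]) auto
  have "Re (mu k R \<beta> (z 0)) > 0"
  proof -
    have "mu k R \<beta> (z 0) = of_real (sqrt k * sin \<beta> * Re s) / csqrt (q_fun R \<beta> (z 0))"
      by (simp add: mu_eq z_def Complex_eq)
    moreover have "Re (csqrt (q_fun R \<beta> (z 0))) > 0"
      by (intro Re_csqrt_pos q_fun_notin z) simp
    ultimately show ?thesis
      using k s(2) sin_pos z[of 0] by (simp add: Re_divide power2_eq_square[symmetric] sum_power2_gt_zero_iff del: csqrt.sel)
  qed
  with neg obtain t where t: "0 \<le> t" "t \<le> 1" "Re (mu k R \<beta> (z t)) = 0"
    using IVT2'[OF _ _ _ cont, of 0] by (auto simp: z_def)
  \<comment> \<open>On the segment the real part is fixed and the imaginary part is no larger than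
    at s, so the sector condition persists at the zero.\<close>
  have "(t * Im s)\<^sup>2 \<le> (Im s)\<^sup>2"
    using t by (simp add: power_mult_distrib mult_left_le_one_le power_le_one)
  with sector have "(Im (z t))\<^sup>2 < (11 + 5 * sqrt 5) / 2 * (Re (z t))\<^sup>2"
    by (simp add: z_def)
  with Re_mu_nonzero[OF k z[of t]] t s(2) show False
    by (simp add: z_def)
qed

end

text \<open>In the right half plane the argument is the arctangent of Im s / Re s, so the angle
  condition becomes the quadratic inequality used by \<open>Re_mu_pos\<close>. The origin stands
  apart: its \<open>Arg\<close> is 0, but it fails the strict inequalities.\<close>

lemma S_region_cases:
  assumes "s \<in> S_region L \<delta>"
  shows "\<bar>Im s\<bar> < (1 - \<delta>) * L"
    and "s = 0 \<or> 0 < Re s \<and> (Im s)\<^sup>2 < (11 + 5 * sqrt 5) / 2 * (Re s)\<^sup>2"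
proof -
  define K :: real where "K = (11 + 5 * sqrt 5) / 2"
  from assms have arg: "\<bar>Arg s\<bar> < arctan (sqrt K)" and im: "\<bar>Im s\<bar> < (1 - \<delta>) * L"
    by (auto simp: S_region_def K_def)
  show "\<bar>Im s\<bar> < (1 - \<delta>) * L" by (fact im)
  show "s = 0 \<or> 0 < Re s \<and> (Im s)\<^sup>2 < (11 + 5 * sqrt 5) / 2 * (Re s)\<^sup>2"
  proof (cases "s = 0")
    case False
    have "\<bar>Arg s\<bar> < pi / 2"
      using arg arctan_ubound[of "sqrt K"] by linarith
    then have "cos (Arg s) > 0"
      by (intro cos_gt_zero_pi) auto
    moreover have "Re s = norm s * cos (Arg s)"
      using rcis_cmod_Arg[of s] by (metis Re_rcis)
    ultimately have re: "Re s > 0" using False by simp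
    then have "\<bar>arctan (Im s / Re s)\<bar> < arctan (sqrt K)"
      using arg by (simp add: arg_conv_arctan)
    then have "arctan \<bar>Im s / Re s\<bar> < arctan (sqrt K)"
      by (simp add: abs_if arctan_minus split: if_splits)
    then have "\<bar>Im s / Re s\<bar> < sqrt K"
      by (simp only: arctan_less_iff)
    then have "(\<bar>Im s / Re s\<bar>)\<^sup>2 < (sqrt K)\<^sup>2"
      by (intro power_strict_mono) auto
    moreover have "0 \<le> K" by (simp add: K_def)
    ultimately have "(Im s)\<^sup>2 / (Re s)\<^sup>2 < K"
      by (simp add: power_divide)
    with re show ?thesis
      by (simp add: K_def[symmetric] pos_divide_less_eq)
  qed simp
qed

section \<open>Lower bounds for \<open>rho\<close> and upper bounds for \<open>g\<close>\<close>

context strip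
begin

text \<open>With z = s - R cos \<beta> and L = R sin \<beta>, the square of \<open>rho\<close> is (z
  + i L) (z - i L), so a common lower bound for both factors bounds \<open>rho\<close>. Their
  imaginary parts are at least \<delta> L in modulus; their real parts are both Re z.\<close>

lemma norm_rho_ge:
  assumes y: "\<bar>Im s\<bar> \<le> (1 - \<delta>) * (R * sin \<beta>)" and \<delta>: "0 < \<delta>"
  shows "\<delta> * (R * sin \<beta>) \<le> norm (rho R \<beta> s)" "\<bar>Re s - R * cos \<beta>\<bar> \<le> norm (rho R \<beta> s)"
proof -
  define L where "L = R * sin \<beta>"
  define z where "z = s - of_real (R * cos \<beta>)"
  have L: "L > 0" using R sin_pos by (simp add: L_def)
  have "(norm (rho R \<beta> s))\<^sup>2 = norm (z\<^sup>2 + of_real (L\<^sup>2))"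
    using rho_power2[of R \<beta> s] by (simp add: z_def L_def flip: norm_power)
  also have "z\<^sup>2 + of_real (L\<^sup>2) = (z + \<i> * of_real L) * (z - \<i> * of_real L)"
    by (simp add: power2_eq_square algebra_simps)
  finally have sq: "(norm (rho R \<beta> s))\<^sup>2 = norm (z + \<i> * of_real L) * norm (z - \<i> * of_real L)"
    by (simp only: norm_mult)
  have iz: "Im z = Im s" "Re z = Re s - R * cos \<beta>" by (simp_all add: z_def)
  have factor: "b \<le> norm (rho R \<beta> s)"
    if "0 \<le> b" "b \<le> norm (z + \<i> * of_real L)" "b \<le> norm (z - \<i> * of_real L)" for b
  proof (rule power2_le_imp_le)
    show "b\<^sup>2 \<le> (norm (rho R \<beta> s))\<^sup>2"
      unfolding sq unfolding power2_eq_square using that by (intro mult_mono) auto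
  qed simp
  have "\<bar>Im s\<bar> \<le> L - \<delta> * L" using y by (simp add: L_def algebra_simps)
  then have "\<delta> * L \<le> \<bar>Im (z + \<i> * of_real L)\<bar>" "\<delta> * L \<le> \<bar>Im (z - \<i> * of_real L)\<bar>"
    by (simp_all add: iz)
  then have "\<delta> * L \<le> norm (rho R \<beta> s)"
    using \<delta> L by (intro factor order_trans[OF _ abs_Im_le_cmod]) simp_all
  then show "\<delta> * (R * sin \<beta>) \<le> norm (rho R \<beta> s)" by (simp add: L_def)
  have "\<bar>Re z\<bar> \<le> norm (rho R \<beta> s)"
  proof (rule factor)
    show "\<bar>Re z\<bar> \<le> norm (z + \<i> * of_real L)"
      using abs_Re_le_cmod[of "z + \<i> * of_real L"] by simp
    show "\<bar>Re z\<bar> \<le> norm (z - \<i> * of_real L)"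
      using abs_Re_le_cmod[of "z - \<i> * of_real L"] by simp
  qed simp
  then show "\<bar>Re s - R * cos \<beta>\<bar> \<le> norm (rho R \<beta> s)" by (simp add: iz)
qed

text \<open>The quotient is split into |s - 2 R cos \<beta>| / |\<rho> + R|, at most 3, and |sqrt q|
  / |\<rho>|. The bound contains R and \<beta> only through R sin \<beta>, which makes it uniform in
  the angle of incidence.\<close>

lemma norm_algebraic_term_le:
  assumes \<delta>: "0 < \<delta>" and y: "\<bar>Im s\<bar> \<le> (1 - \<delta>) * (R * sin \<beta>)"
  shows "norm ((s - of_real (2 * R * cos \<beta>)) * csqrt (q_fun R \<beta> s) /
      (2 * rho R \<beta> s * (rho R \<beta> s + of_real R)))
    \<le> 3 / 2 * sqrt ((2 + 2 / \<delta>) / (\<delta> * (R * sin \<beta>)))"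
proof -
  define L where "L = R * sin \<beta>"
  define z where "z = s - of_real (R * cos \<beta>)"
  define \<rho> where "\<rho> = rho R \<beta> s"
  have L: "L > 0" using R sin_pos by (simp add: L_def)
  have LR: "L \<le> R" using R by (simp add: L_def)
  have yL: "\<bar>Im s\<bar> \<le> L - \<delta> * L" using y by (simp add: L_def algebra_simps)
  have \<delta>L: "0 < \<delta> * L" using \<delta> L by simp
  have s: "s \<in> strip_set" using yL \<delta>L by (simp add: strip_set_def L_def)
  have ge: "\<delta> * L \<le> norm \<rho>" "\<bar>Re z\<bar> \<le> norm \<rho>"
    using norm_rho_ge[OF y \<delta>] by (simp_all add: L_def \<rho>_def z_def)
  have \<rho>0: "norm \<rho> > 0" using ge \<delta>L by linarith
  have re: "Re \<rho> > 0" using Re_rho_pos[OF s] by (simp add: \<rho>_def)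
  have nz: "norm z \<le> norm \<rho> + L"
    using cmod_le[of z] ge yL \<delta>L by (simp add: z_def)
  have "norm (s - of_real (2 * R * cos \<beta>)) = norm (z - of_real (R * cos \<beta>))"
    by (simp add: z_def mult.assoc)
  also have "\<dots> \<le> norm z + \<bar>R * cos \<beta>\<bar>"
    by (metis norm_of_real norm_triangle_ineq4)
  also have "\<bar>R * cos \<beta>\<bar> \<le> R" using R by (simp add: abs_mult mult_left_le)
  finally have num: "norm (s - of_real (2 * R * cos \<beta>)) \<le> norm \<rho> + 2 * R"
    using nz LR by linarith
  have "R \<le> Re (\<rho> + of_real R)" using re by simp
  then have den1: "R \<le> norm (\<rho> + of_real R)" using complex_Re_le_cmod order_trans by blast
  have den2: "norm \<rho> \<le> norm (\<rho> + of_real R)"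
    using re R unfolding cmod_def by (intro real_sqrt_le_mono add_mono) (auto intro!: power_mono)
  have f1: "norm (s - of_real (2 * R * cos \<beta>)) / norm (\<rho> + of_real R) \<le> 3"
    using num den1 den2 R by (simp add: divide_le_eq)
  \<comment> \<open>Expressed through \<open>z\<close>, the constant term R - R (cos \<beta>)^2 is L
    sin \<beta>, so that R, which may be far larger than L, drops out of the estimate.\<close>
  have "q_fun R \<beta> s = of_real (L * sin \<beta>) - z * of_real (cos \<beta>) + \<rho>"
  proof -
    have "complex_of_real (L * sin \<beta>) = of_real (R * (1 - (cos \<beta>)\<^sup>2))"
      unfolding L_def sin_squared_eq[symmetric] by (simp add: power2_eq_square mult.assoc)
    also have "\<dots> = of_real R - of_real (R * cos \<beta>) * of_real (cos \<beta>)"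
      by (simp add: power2_eq_square algebra_simps)
    finally show ?thesis by (simp add: q_fun_def z_def \<rho>_def algebra_simps)
  qed
  then have "norm (q_fun R \<beta> s) \<le> norm (complex_of_real (L * sin \<beta>)) + norm (z * of_real (cos \<beta>)) + norm \<rho>"
    by (smt (verit) norm_triangle_ineq norm_triangle_ineq4)
  moreover have "norm (complex_of_real (L * sin \<beta>)) \<le> L"
    using L by (simp add: norm_mult mult_left_le)
  moreover have "norm (z * of_real (cos \<beta>)) \<le> norm z"
    by (simp add: norm_mult mult_left_le)
  ultimately have "norm (q_fun R \<beta> s) \<le> 2 * L + 2 * norm \<rho>"
    using nz by linarith
  also have "2 * L \<le> 2 / \<delta> * norm \<rho>"
    using ge(1) \<delta> by (simp add: field_simps)
  finally have q: "norm (q_fun R \<beta> s) \<le> (2 + 2 / \<delta>) * norm \<rho>"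
    by (simp add: algebra_simps)
  have "norm (csqrt (q_fun R \<beta> s)) / norm \<rho> = sqrt (norm (q_fun R \<beta> s) / (norm \<rho>)\<^sup>2)"
    by (simp add: norm_csqrt real_sqrt_divide)
  also have "\<dots> \<le> sqrt ((2 + 2 / \<delta>) / (\<delta> * L))"
  proof (rule real_sqrt_le_mono)
    have "norm (q_fun R \<beta> s) / (norm \<rho>)\<^sup>2 \<le> (2 + 2 / \<delta>) * norm \<rho> / (norm \<rho>)\<^sup>2"
      using q by (rule divide_right_mono) simp
    also have "\<dots> = (2 + 2 / \<delta>) / norm \<rho>"
      using \<rho>0 by (simp add: power2_eq_square)
    also have "\<dots> \<le> (2 + 2 / \<delta>) / (\<delta> * L)"
      using ge(1) \<delta>L \<delta> \<rho>0 L by (intro divide_left_mono mult_pos_pos) auto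
    finally show "norm (q_fun R \<beta> s) / (norm \<rho>)\<^sup>2 \<le> (2 + 2 / \<delta>) / (\<delta> * L)" .
  qed
  finally have f2: "norm (csqrt (q_fun R \<beta> s)) / norm \<rho> \<le> sqrt ((2 + 2 / \<delta>) / (\<delta> * L))" .
  have "norm ((s - of_real (2 * R * cos \<beta>)) * csqrt (q_fun R \<beta> s) / (2 * \<rho> * (\<rho> + of_real R)))
    = norm (s - of_real (2 * R * cos \<beta>)) / norm (\<rho> + of_real R) / 2 * (norm (csqrt (q_fun R \<beta> s)) / norm \<rho>)"
    by (simp add: norm_mult norm_divide)
  also have "\<dots> \<le> 3 / 2 * sqrt ((2 + 2 / \<delta>) / (\<delta> * L))"
    using f1 f2 by (intro mult_mono) auto
  finally show ?thesis by (simp only: L_def \<rho>_def)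
qed

text \<open>\<open>mu\<close> has nonnegative real part in the region, so the \<open>F_fun\<close>
  term is of order k. The algebraic term is of order sqrt (k / L); this is k times (k L)^(-1/2), and
  \<open>\<kappa>\<close> bounds the last factor.\<close>

lemma norm_g_le:
  assumes k: "0 < k" and \<delta>: "0 < \<delta>" and s: "s \<in> S_region (R * sin \<beta>) \<delta>"
    and \<kappa>: "0 < \<kappa>" "\<kappa> \<le> k * (R * sin \<beta>)"
  shows "norm (g k s R \<beta>) \<le> (3 / 2 * sqrt ((2 + 2 / \<delta>) / (\<delta> * \<kappa>)) + 3 / 2) * k"
proof -
  define L where "L = R * sin \<beta>"
  have L: "L > 0" using R sin_pos by (simp add: L_def)
  have y: "\<bar>Im s\<bar> \<le> (1 - \<delta>) * L" using S_region_cases(1)[OF s] by (simp add: L_def)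
  moreover have "(1 - \<delta>) * L < L" using \<delta> L by (simp add: algebra_simps)
  ultimately have strip: "s \<in> strip_set" by (simp add: strip_set_def L_def)
  define T where "T = (s - of_real (2 * R * cos \<beta>)) * csqrt (q_fun R \<beta> s) /
      (2 * rho R \<beta> s * (rho R \<beta> s + of_real R))"
  have "Re (mu k R \<beta> s) \<ge> 0"
    using S_region_cases(2)[OF s]
  proof
    assume "s = 0"
    then show ?thesis by (simp add: mu_def)
  next
    assume "0 < Re s \<and> (Im s)\<^sup>2 < (11 + 5 * sqrt 5) / 2 * (Re s)\<^sup>2"
    with Re_mu_pos[OF k strip] show ?thesis by simp
  qed
  then have F: "norm (F_fun (mu k R \<beta> s)) \<le> 3 / 2"
    by (rule norm_F_fun_le)
  have T: "norm (of_real (sqrt k) * T) \<le> 3 / 2 * sqrt ((2 + 2 / \<delta>) / (\<delta> * \<kappa>)) * k"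
  proof -
    have "norm (of_real (sqrt k) * T) \<le> sqrt k * (3 / 2 * sqrt ((2 + 2 / \<delta>) / (\<delta> * L)))"
      using norm_algebraic_term_le[OF \<delta>, of s] y k unfolding norm_mult T_def L_def
      by (intro mult_mono) auto
    also have "\<dots> = 3 / 2 * sqrt ((2 + 2 / \<delta>) / (\<delta> * (k * L))) * k"
    proof -
      have "k * sqrt ((2 + 2 / \<delta>) / (\<delta> * (k * L))) = sqrt (k\<^sup>2 * ((2 + 2 / \<delta>) / (\<delta> * (k * L))))"
        unfolding real_sqrt_mult[of "k\<^sup>2"] using k by simp
      also have "k\<^sup>2 * ((2 + 2 / \<delta>) / (\<delta> * (k * L))) = k * ((2 + 2 / \<delta>) / (\<delta> * L))"
        using k by (simp add: power2_eq_square)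
      finally show ?thesis unfolding real_sqrt_mult[of k] by (simp only: mult_ac)
    qed
    also have "\<dots> \<le> 3 / 2 * sqrt ((2 + 2 / \<delta>) / (\<delta> * \<kappa>)) * k"
      using k \<delta> \<kappa> L unfolding L_def[symmetric]
      by (intro mult_right_mono mult_left_mono real_sqrt_le_mono divide_left_mono) auto
    finally show ?thesis .
  qed
  have "g k s R \<beta> = exp (3 * of_real pi * \<i> / 4) / of_real (sqrt pi) * (of_real (sqrt k) * T)
      - \<i> * of_real (k * sin \<beta>) * F_fun (mu k R \<beta> s)"
    by (simp add: g_eq_g_reg[OF k strip] g_reg_def T_def mult.assoc)
  also have "norm \<dots> \<le> norm (exp (3 * of_real pi * \<i> / 4) / of_real (sqrt pi) * (of_real (sqrt k) * T))
      + norm (\<i> * of_real (k * sin \<beta>) * F_fun (mu k R \<beta> s))"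
    by (rule norm_triangle_ineq4)
  also have "norm (exp (3 * of_real pi * \<i> / 4) / of_real (sqrt pi) * (of_real (sqrt k) * T))
      \<le> norm (of_real (sqrt k) * T)"
  proof -
    have "1 \<le> sqrt pi" using pi_gt3 by simp
    then have "norm (exp (3 * of_real pi * \<i> / 4) / complex_of_real (sqrt pi)) \<le> 1"
      by (simp add: norm_divide)
    then show ?thesis
      unfolding norm_mult[of "_ / _"] by (rule mult_left_le_one_le[OF norm_ge_zero norm_ge_zero])
  qed
  also have "norm (\<i> * of_real (k * sin \<beta>) * F_fun (mu k R \<beta> s)) \<le> k * (3 / 2)"
    unfolding norm_mult using F k sin_pos by (intro mult_mono) (auto simp: norm_mult mult_left_le)
  finally show ?thesis using T by (simp add: algebra_simps)
qed

text \<open>The region can contain its apex 0 and so need not be open; analyticity is inherited from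
  the open strip around it.\<close>

lemma g_analytic_on:
  assumes k: "0 < k" and \<delta>: "0 < \<delta>"
  shows "(\<lambda>s. g k s R \<beta>) analytic_on S_region (R * sin \<beta>) \<delta>"
proof (rule analytic_on_subset)
  show "(\<lambda>s. g k s R \<beta>) analytic_on strip_set"
    using g_reg_holomorphic_on[of k] g_eq_g_reg[OF k] open_strip_set
    by (simp add: analytic_on_open cong: holomorphic_cong)
  show "S_region (R * sin \<beta>) \<delta> \<subseteq> strip_set"
  proof
    fix s assume "s \<in> S_region (R * sin \<beta>) \<delta>"
    then have "\<bar>Im s\<bar> < (1 - \<delta>) * (R * sin \<beta>)" by (rule S_region_cases)
    also have "\<dots> < R * sin \<beta>" using R sin_pos \<delta> by simp
    finally show "s \<in> strip_set" by (simp add: strip_set_def)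
  qed
qed

end

section \<open>The canonical diffraction solution on the side\<close>

text \<open>Below \<open>p = - x\<^sub>2 > 0\<close>, so \<open>(- s, - p) = r (- sin a, - cos a)\<close> with \<open>a = arg_nc s p\<close>, and \<open>e = \<pi> - \<alpha>\<close> or \<open>\<alpha> - \<pi>\<close>.\<close>

definition arg_nc :: "real \<Rightarrow> real \<Rightarrow> real" where
  "arg_nc s p = arctan (s / p)"

text \<open>The argument of \<open>Fr\<close>. For |e| < \<pi> / 2 it changes sign at s = p tan e,
  the shadow boundary. \<open>p\<close> is kept variable because the normal derivative is taken in
  \<open>p\<close>.\<close>

definition W_fun :: "real \<Rightarrow> real \<Rightarrow> real \<Rightarrow> real \<Rightarrow> real" where
  "W_fun k e s p = sqrt (2 * k) * (sqrt (r_nc p s) * sin ((e - arg_nc s p) / 2))"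

text \<open>The phase is k r cos (e - a): this is the incident wave for e = \<pi> - \<alpha> and the
  reflected wave for e = \<alpha> - \<pi>.\<close>

definition wave :: "real \<Rightarrow> real \<Rightarrow> real \<Rightarrow> real \<Rightarrow> complex" where
  "wave k e s p = exp (\<i> * of_real (k * (p * cos e + s * sin e)))"

definition G_fun :: "real \<Rightarrow> real \<Rightarrow> real \<Rightarrow> real \<Rightarrow> complex" where
  "G_fun k e s p = wave k e s p * Fr (of_real (W_fun k e s p))"

lemma r_nc_pos: "0 < p \<Longrightarrow> 0 < r_nc p s"
  by (simp add: r_nc_def add_nonneg_pos)

lemma polar_nc:
  assumes "0 < p"
  shows "r_nc p s * cos (arg_nc s p) = p" "r_nc p s * sin (arg_nc s p) = s"
proof -
  have "1 + (s / p)\<^sup>2 = (s\<^sup>2 + p\<^sup>2) / p\<^sup>2"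
    using assms by (simp add: field_simps)
  then have q: "sqrt (1 + (s / p)\<^sup>2) = r_nc p s / p"
    using assms by (simp add: real_sqrt_divide r_nc_def)
  show "r_nc p s * cos (arg_nc s p) = p" "r_nc p s * sin (arg_nc s p) = s"
    using assms r_nc_pos[OF assms, of s]
    by (simp_all add: arg_nc_def cos_arctan sin_arctan q)
qed

lemma polar_nc_cos_diff:
  assumes "0 < p"
  shows "r_nc p s * cos (e - arg_nc s p) = p * cos e + s * sin e"
proof -
  have "r_nc p s * cos (e - arg_nc s p) =
      (r_nc p s * cos (arg_nc s p)) * cos e + (r_nc p s * sin (arg_nc s p)) * sin e"
    by (simp add: cos_diff algebra_simps)
  then show ?thesis by (simp add: polar_nc assms)
qed

text \<open>By the half-angle formula, the square is the phase difference between exp (i k r) and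
  the plane wave.\<close>

lemma W_fun_power2:
  assumes "0 < p" "0 < k"
  shows "(W_fun k e s p)\<^sup>2 = k * r_nc p s - k * (p * cos e + s * sin e)"
proof -
  have "(W_fun k e s p)\<^sup>2 = k * r_nc p s * (2 * (sin ((e - arg_nc s p) / 2))\<^sup>2)"
    using assms r_nc_pos[of p s] by (simp add: W_fun_def power_mult_distrib)
  also have "2 * (sin ((e - arg_nc s p) / 2))\<^sup>2 = 1 - cos (e - arg_nc s p)"
  proof -
    have "2 * ((e - arg_nc s p) / 2) = e - arg_nc s p" by simp
    then have "cos (e - arg_nc s p) = 1 - 2 * (sin ((e - arg_nc s p) / 2))\<^sup>2"
      by (metis cos_double_sin)
    then show ?thesis by linarith
  qed
  finally show ?thesis
    by (simp add: algebra_simps flip: polar_nc_cos_diff[OF assms(1)])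
qed

text \<open>With e = \<pi> - \<alpha>, \<theta> - \<alpha> = \<pi> + (e - a) but \<theta> + \<alpha>
  = 3 \<pi> + (- e - a), so the cosines of the half angles become a negative and a positive sine.
  Only the second term needs the reflection of \<open>Fr\<close>, which produces the plane
  wave.\<close>

lemma u_d_cart_eq:
  assumes p: "0 < p" and k: "0 < k"
  shows "u_d_cart k \<alpha> (- s, - p) =
    G_fun k (pi - \<alpha>) s p + G_fun k (\<alpha> - pi) s p - wave k (\<alpha> - pi) s p"
proof -
  define a r where "a = arg_nc s p" and "r = r_nc p s"
  have r: "r > 0" using p by (simp add: r_def r_nc_pos)
  have E: "E_fun k r \<psi> = G_fun k e s p" if c: "cos \<psi> = - cos (e - a)" "cos (\<psi> / 2) = - sin ((e - a) / 2)" for \<psi> e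
  proof -
    have "k * r * cos \<psi> = - (k * (p * cos e + s * sin e))"
      by (simp add: c r_def a_def flip: polar_nc_cos_diff[OF p])
    moreover have "- sqrt (2 * k * r) * cos (\<psi> / 2) = W_fun k e s p"
      using k r by (simp add: c W_fun_def real_sqrt_mult r_def a_def)
    ultimately show ?thesis
      unfolding E_fun_def G_fun_def wave_def by simp
  qed
  have E': "E_fun k r \<psi> = wave k e s p - G_fun k e s p" if c: "cos \<psi> = - cos (e - a)" "cos (\<psi> / 2) = sin ((e - a) / 2)" for \<psi> e
  proof -
    have "k * r * cos \<psi> = - (k * (p * cos e + s * sin e))"
      by (simp add: c r_def a_def flip: polar_nc_cos_diff[OF p])
    then have ex: "exp (- \<i> * of_real (k * r * cos \<psi>)) = wave k e s p"
      unfolding wave_def by simp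
    have w: "- sqrt (2 * k * r) * cos (\<psi> / 2) = - W_fun k e s p"
      using k r by (simp add: c W_fun_def real_sqrt_mult r_def a_def)
    show ?thesis
      unfolding E_fun_def ex w by (simp add: G_fun_def Fr_minus algebra_simps)
  qed
  have n: "norm (- s, - p) = r" "theta_nc (- s, - p) = 2 * pi - a"
    by (simp_all add: norm_Pair r_def r_nc_def theta_nc_def a_def arg_nc_def)
  have "E_fun k r (2 * pi - a - \<alpha>) = G_fun k (pi - \<alpha>) s p"
  proof (rule E)
    have "2 * pi - a - \<alpha> = pi + (pi - \<alpha> - a)" by simp
    then show "cos (2 * pi - a - \<alpha>) = - cos (pi - \<alpha> - a)" by (simp only: cos_add cos_pi sin_pi, simp?)
    have "(2 * pi - a - \<alpha>) / 2 = pi / 2 + (pi - \<alpha> - a) / 2" by (simp add: field_simps)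
    then show "cos ((2 * pi - a - \<alpha>) / 2) = - sin ((pi - \<alpha> - a) / 2)"
      by (simp only: cos_add cos_pi_half sin_pi_half, simp?)
  qed
  moreover have "E_fun k r (2 * pi - a + \<alpha>) = wave k (\<alpha> - pi) s p - G_fun k (\<alpha> - pi) s p"
  proof (rule E')
    have "2 * pi - a + \<alpha> = pi + (pi + (pi + (\<alpha> - pi - a)))" by simp
    then show "cos (2 * pi - a + \<alpha>) = - cos (\<alpha> - pi - a)"
      by (simp only: cos_add sin_add cos_pi sin_pi, simp?)
    have "(2 * pi - a + \<alpha>) / 2 = pi + (pi / 2 + (\<alpha> - pi - a) / 2)" by (simp add: field_simps)
    then show "cos ((2 * pi - a + \<alpha>) / 2) = sin ((\<alpha> - pi - a) / 2)"
      by (simp only: cos_add sin_add cos_pi_half sin_pi_half cos_pi sin_pi, simp?)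
  qed
  ultimately show ?thesis by (simp add: u_d_cart_def u_d_def n)
qed

section \<open>Normal derivatives on the side\<close>

lemma DERIV_r_nc:
  assumes "0 < p"
  shows "((\<lambda>p. r_nc p s) has_real_derivative cos (arg_nc s p)) (at p)"
proof -
  have "cos (arg_nc s p) = p / r_nc p s"
    using polar_nc(1)[OF assms, of s] r_nc_pos[OF assms, of s] by (simp add: field_simps)
  then have eq: "cos (arg_nc s p) = inverse (sqrt (s\<^sup>2 + p\<^sup>2)) / 2 * (2 * p)"
    by (simp add: r_nc_def field_simps)
  have "((\<lambda>p. s\<^sup>2 + p\<^sup>2) has_real_derivative 2 * p) (at p)"
    by (auto intro!: derivative_eq_intros)
  from DERIV_chain2[OF DERIV_real_sqrt this] show ?thesis
    unfolding eq r_nc_def using assms by (simp add: add_nonneg_pos)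
qed

lemma DERIV_arg_nc:
  assumes "0 < p"
  shows "((\<lambda>p. arg_nc s p) has_real_derivative - sin (arg_nc s p) / r_nc p s) (at p)"
proof -
  have "- sin (arg_nc s p) / r_nc p s = - s / (r_nc p s)\<^sup>2"
    using polar_nc(2)[OF assms, of s] r_nc_pos[OF assms, of s]
    by (simp add: field_simps power2_eq_square)
  also have "\<dots> = - s / (s\<^sup>2 + p\<^sup>2)" by (simp add: r_nc_def)
  also have "\<dots> = inverse (1 + (s / p)\<^sup>2) * (- s / p\<^sup>2)"
    using assms by (simp add: field_simps add_nonneg_pos)
  finally have eq: "- sin (arg_nc s p) / r_nc p s = inverse (1 + (s / p)\<^sup>2) * (- s / p\<^sup>2)" .
  have "((\<lambda>p. s / p) has_real_derivative - s / p\<^sup>2) (at p)"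
    using assms by (auto intro!: derivative_eq_intros simp: power2_eq_square)
  then have "((\<lambda>p. arctan (s / p)) has_real_derivative inverse (1 + (s / p)\<^sup>2) * (- s / p\<^sup>2)) (at p)"
    by (rule DERIV_chain2[OF DERIV_arctan])
  then show ?thesis
    unfolding eq by (simp only: arg_nc_def)
qed

lemma DERIV_W_fun:
  assumes p: "0 < p" and k: "0 < k"
  shows "((\<lambda>p. W_fun k e s p) has_real_derivative
    sqrt (k / (2 * r_nc p s)) * sin ((e + arg_nc s p) / 2)) (at p)"
proof -
  define a r where "a = arg_nc s p" and "r = r_nc p s"
  have r: "r > 0" using p by (simp add: r_def r_nc_pos)
  have "((\<lambda>p. W_fun k e s p) has_real_derivative
     sqrt (2 * k) * (inverse (sqrt r) / 2 * cos a * sin ((e - a) / 2) +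
       cos ((e - a) / 2) * ((0 - (- sin a / r)) / 2) * sqrt r)) (at p)"
    using r unfolding W_fun_def a_def r_def
    by (intro DERIV_cmult DERIV_mult DERIV_chain2[OF DERIV_real_sqrt] DERIV_chain2[OF DERIV_sin]
        DERIV_cdivide DERIV_diff DERIV_const DERIV_r_nc DERIV_arg_nc p)
  also have "sqrt (2 * k) * (inverse (sqrt r) / 2 * cos a * sin ((e - a) / 2) +
       cos ((e - a) / 2) * ((0 - (- sin a / r)) / 2) * sqrt r) =
     sqrt (2 * k) / (2 * sqrt r) * (sin ((e - a) / 2) * cos a + cos ((e - a) / 2) * sin a)"
  proof -
    have "sqrt r / r = 1 / sqrt r" using r by (simp add: real_div_sqrt field_simps)
    then have "cos ((e - a) / 2) * ((0 - (- sin a / r)) / 2) * sqrt r = cos ((e - a) / 2) * sin a / (2 * sqrt r)"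
    proof -
      have "cos ((e - a) / 2) * ((0 - (- sin a / r)) / 2) * sqrt r = cos ((e - a) / 2) * sin a / 2 * (sqrt r / r)"
        by simp
      with \<open>sqrt r / r = 1 / sqrt r\<close> show ?thesis by simp
    qed
    then show ?thesis using r by (simp add: field_simps)
  qed
  also have "sin ((e - a) / 2) * cos a + cos ((e - a) / 2) * sin a = sin ((e + a) / 2)"
  proof -
    have "(e + a) / 2 = (e - a) / 2 + a" by (simp add: field_simps)
    then show ?thesis by (simp only: sin_add)
  qed
  also have "sqrt (2 * k) / (2 * sqrt r) = sqrt (k / (2 * r))"
  proof -
    have "sqrt (2 * k) / (2 * sqrt r) = sqrt (2 * k) / (sqrt 4 * sqrt r)" by simp
    also have "\<dots> = sqrt (2 * k / (4 * r))" by (simp only: real_sqrt_divide real_sqrt_mult)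
    also have "2 * k / (4 * r) = k / (2 * r)" using r by (simp add: field_simps)
    finally show ?thesis .
  qed
  finally show ?thesis by (simp only: a_def r_def)
qed

text \<open>The derivative of \<open>G\<close> along the normal \<open>(0, 1)\<close>, which points towards decreasing \<open>p\<close>.\<close>

definition G_normal :: "real \<Rightarrow> real \<Rightarrow> real \<Rightarrow> real \<Rightarrow> complex" where
  "G_normal k e s p = exp (\<i> * of_real (k * r_nc p s)) *
     (exp (- \<i> * of_real pi / 4) / of_real (sqrt pi) *
         of_real (sqrt (k / (2 * r_nc p s)) * sin ((e + arg_nc s p) / 2))
      - \<i> * of_real (k * cos e) * F_fun (of_real (W_fun k e s p)))"

lemma has_vector_derivative_wave:
  "((\<lambda>p. wave k e s p) has_vector_derivative \<i> * of_real (k * cos e) * wave k e s p) (at p)"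
proof -
  have "((\<lambda>z. exp (\<i> * (of_real k * (z * of_real (cos e) + of_real (s * sin e)))))
      has_field_derivative \<i> * of_real (k * cos e) * wave k e s p) (at (of_real p))"
    by (auto intro!: derivative_eq_intros simp: wave_def)
  then have "((\<lambda>p. exp (\<i> * (of_real k * (of_real p * of_real (cos e) + of_real (s * sin e)))))
      has_vector_derivative \<i> * of_real (k * cos e) * wave k e s p) (at p)"
    by (rule has_vector_derivative_real_field)
  then show ?thesis by (simp add: wave_def)
qed

lemma wave_eq_exp_W:
  assumes "0 < p" "0 < k"
  shows "wave k e s p = exp (\<i> * of_real (k * r_nc p s)) * exp (- \<i> * (of_real (W_fun k e s p))\<^sup>2)"
proof -
  have "\<i> * of_real (k * r_nc p s) + - \<i> * (of_real (W_fun k e s p))\<^sup>2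
      = \<i> * of_real (k * (p * cos e + s * sin e))"
    unfolding of_real_power[symmetric] W_fun_power2[OF assms] by (simp add: algebra_simps)
  then show ?thesis
    unfolding wave_def by (simp only: exp_add[symmetric])
qed

text \<open>The derivative of \<open>Fr\<close> carries exp (i W^2), which cancels the Gaussian in
  \<open>wave_eq_exp_W\<close> and leaves the algebraic term times exp (i k r). Differentiating the
  plane wave gives the \<open>F_fun\<close> term.\<close>

lemma has_vector_derivative_G_fun:
  assumes p: "0 < p" and k: "0 < k"
  shows "((\<lambda>p. G_fun k e s p) has_vector_derivative - G_normal k e s p) (at p)"
proof -
  define w W' where "w = complex_of_real (W_fun k e s p)"
    and "W' = sqrt (k / (2 * r_nc p s)) * sin ((e + arg_nc s p) / 2)"
  have "((\<lambda>p. complex_of_real (W_fun k e s p)) has_vector_derivative of_real W') (at p)"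
    using DERIV_W_fun[OF p k, of e s] unfolding W'_def
    by (intro has_vector_derivative_of_real) (simp add: has_real_derivative_iff_has_vector_derivative)
  from field_vector_diff_chain_within[OF this has_field_derivative_at_within[OF has_field_derivative_Fr]]
  have "((\<lambda>p. Fr (of_real (W_fun k e s p))) has_vector_derivative
      of_real W' * (- exp (- \<i> * of_real pi / 4) / of_real (sqrt pi) * exp (\<i> * w\<^sup>2))) (at p)"
    by (simp only: o_def w_def)
  from has_vector_derivative_mult[OF has_vector_derivative_wave this]
  have d: "((\<lambda>p. G_fun k e s p) has_vector_derivative
      wave k e s p * (of_real W' * (- exp (- \<i> * of_real pi / 4) / of_real (sqrt pi) * exp (\<i> * w\<^sup>2))) +
      \<i> * of_real (k * cos e) * wave k e s p * Fr w) (at p)"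
    by (simp only: G_fun_def w_def)
  have wv: "wave k e s p = exp (\<i> * of_real (k * r_nc p s)) * exp (- \<i> * w\<^sup>2)"
    unfolding w_def by (rule wave_eq_exp_W[OF p k])
  have "exp (- \<i> * w\<^sup>2) * exp (\<i> * w\<^sup>2) = 1"
    by (simp flip: exp_add)
  then have *: "exp (- \<i> * w\<^sup>2) * (A * (B * exp (\<i> * w\<^sup>2))) = A * B" for A B
    by (metis mult.commute mult.left_commute mult.right_neutral)
  have "wave k e s p * (of_real W' * (- exp (- \<i> * of_real pi / 4) / of_real (sqrt pi) * exp (\<i> * w\<^sup>2))) +
      \<i> * of_real (k * cos e) * wave k e s p * Fr w = - G_normal k e s p"
    unfolding wv G_normal_def W'_def[symmetric] w_def[symmetric] F_fun_def mult.assoc[of "exp (\<i> * of_real (k * r_nc p s))"] *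
    by (simp add: algebra_simps)
  with d show ?thesis by simp
qed

text \<open>Moving a distance t along the normal replaces \<open>p\<close> by \<open>p - t\<close>,
  which accounts for the sign; the two functions can be compared as long as t < p.\<close>

lemma normal_deriv_eq:
  assumes p: "0 < p" and h: "(h has_vector_derivative d) (at p)"
    and f: "\<And>p. 0 < p \<Longrightarrow> f (- s, - p) = h p"
  shows "normal_deriv f (nc_point p s) = - d"
proof -
  have "((\<lambda>t. p - t) has_vector_derivative -1) (at 0 within {0..})"
    by (auto intro!: derivative_eq_intros)
  from vector_diff_chain_within[OF this, of h d]
  have "((\<lambda>t. h (p - t)) has_vector_derivative - d) (at 0 within {0..})"
    using has_vector_derivative_at_within[OF h] by (simp add: o_def)
  then have "((\<lambda>t. f (nc_point p s + t *\<^sub>R nc_normal)) has_vector_derivative - d) (at 0 within {0..})"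
  proof (rule has_vector_derivative_transform_within[OF _ p])
    fix t :: real assume "dist t 0 < p"
    then show "h (p - t) = f (nc_point p s + t *\<^sub>R nc_normal)"
      using f[of "p - t"] by (simp add: nc_point_def nc_normal_def)
  qed simp
  then show ?thesis
    unfolding normal_deriv_def
    by (intro vector_derivative_within) (simp_all add: at_within_Ici_at_right trivial_limit_at_right_real)
qed

lemma normal_deriv_u_inc:
  assumes "0 < p"
  shows "normal_deriv (u_inc k \<alpha>) (nc_point p s) = - (\<i> * of_real (k * cos (pi - \<alpha>)) * wave k (pi - \<alpha>) s p)"
  by (rule normal_deriv_eq[OF assms has_vector_derivative_wave])
     (simp add: u_inc_def plane_wave_def wave_def d_inc_def algebra_simps)

lemma normal_deriv_u_ref:
  assumes "0 < p"
  shows "normal_deriv (u_ref k \<alpha>) (nc_point p s) = - (\<i> * of_real (k * cos (\<alpha> - pi)) * wave k (\<alpha> - pi) s p)"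
  by (rule normal_deriv_eq[OF assms has_vector_derivative_wave])
     (simp add: u_ref_def plane_wave_def wave_def d_ref_def d_inc_def algebra_simps)

lemma Psi_eq_G_normal:
  assumes p: "0 < p" and k: "0 < k"
  shows "Psi k p \<alpha> s = 2 * (G_normal k (pi - \<alpha>) s p + G_normal k (\<alpha> - pi) s p
    - normal_deriv (u_ref k \<alpha>) (nc_point p s))"
proof -
  have "((\<lambda>p. G_fun k (pi - \<alpha>) s p + G_fun k (\<alpha> - pi) s p - wave k (\<alpha> - pi) s p) has_vector_derivative
      - G_normal k (pi - \<alpha>) s p + - G_normal k (\<alpha> - pi) s p
      - \<i> * of_real (k * cos (\<alpha> - pi)) * wave k (\<alpha> - pi) s p) (at p)"
    by (intro has_vector_derivative_diff has_vector_derivative_add has_vector_derivative_wave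
        has_vector_derivative_G_fun p k)
  from normal_deriv_eq[OF p this, of "u_d_cart k \<alpha>"] show ?thesis
    unfolding Psi_def normal_deriv_u_ref[OF p] by (simp add: u_d_cart_eq k)
qed

section \<open>Identification with the function \<open>g\<close>\<close>

lemma csqrt_of_real_power2:
  fixes x :: real
  assumes "0 \<le> x"
  shows "csqrt (of_real (x\<^sup>2)) = of_real x"
  using assms by simp

lemma exp_3_pi_i_4: "exp (3 * of_real pi * \<i> / 4) = - exp (- \<i> * of_real pi / 4)"
proof -
  have "exp (3 * of_real pi * \<i> / 4) = exp (of_real pi * \<i> + - \<i> * of_real pi / 4)"
    by (rule arg_cong[of _ _ exp]) (simp add: field_simps)
  also have "\<dots> = exp (of_real pi * \<i>) * exp (- \<i> * of_real pi / 4)"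
    by (rule exp_add)
  finally show ?thesis by simp
qed

text \<open>Both signs of \<open>\<sigma>\<close> describe the same distance \<open>\<rho> = r\<close>; they differ by the sign of \<open>\<mu> = - \<sigma> W\<close>.\<close>

lemma g_reg_on_nc:
  fixes \<sigma> :: real
  assumes k: "0 < k" and L: "0 < L" and e: "\<bar>e\<bar> < pi / 2" and \<sigma>: "\<sigma> = 1 \<or> \<sigma> = -1"
  shows "g_reg k (L / cos e) (pi / 2 + \<sigma> * e) (of_real (\<sigma> * (s - L * tan e))) =
    - of_real \<sigma> * (exp (- \<i> * of_real pi / 4) / of_real (sqrt pi) *
         of_real (sqrt (k / (2 * r_nc L s)) * sin ((e + arg_nc s L) / 2)))
    - \<i> * of_real (k * cos e) * F_fun (of_real (- \<sigma> * W_fun k e s L))"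
proof -
  define R \<beta> S r a where "R = L / cos e" and "\<beta> = pi / 2 + \<sigma> * e" and "S = \<sigma> * (s - L * tan e)"
    and "r = r_nc L s" and "a = arg_nc s L"
  define C where "C = cos ((e - a) / 2)"
  have ce: "cos e > 0" using e by (intro cos_gt_zero_pi) auto
  have r: "r > 0" using L by (simp add: r_def r_nc_pos)
  have r2: "r\<^sup>2 = s\<^sup>2 + L\<^sup>2" by (simp add: r_def r_nc_def)
  \<comment> \<open>Either sign gives the same sin \<beta>; \<sigma> only flips cos \<beta> up to
    the factor sin e and the direction in which \<open>S\<close> is measured from the shadow
    boundary.\<close>
  have sc: "sin \<beta> = cos e" "cos \<beta> = - \<sigma> * sin e"
    using \<sigma> by (auto simp: \<beta>_def sin_add cos_add)
  have Lc: "L = R * cos e" using ce by (simp add: R_def)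
  have Ss: "S = \<sigma> * (s - R * sin e)" using ce by (simp add: S_def R_def tan_def)
  have rca: "r * cos a = R * cos e" "r * sin a = s"
    using polar_nc[OF L, of s] by (simp_all add: r_def a_def Lc)
  have RSc: "S * cos \<beta> = - (s - R * sin e) * sin e"
    using \<sigma> by (auto simp: Ss sc algebra_simps)
  have "- pi / 2 < (e - a) / 2" "(e - a) / 2 < pi / 2"
    using e arctan_lbound[of "s / L"] arctan_ubound[of "s / L"] by (auto simp: a_def arg_nc_def abs_if split: if_splits)
  \<comment> \<open>Positivity of \<open>C\<close> makes \<open>sqrt (2 * r) * C\<close> the
    principal root of \<open>q_fun\<close>.\<close>
  then have C: "C > 0" unfolding C_def by (intro cos_gt_zero_pi) auto
  have cs: "(cos e)\<^sup>2 = 1 - (sin e)\<^sup>2" by (rule cos_squared_eq)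
  have rho: "rho R \<beta> (of_real S) = of_real r"
  proof -
    have "R\<^sup>2 + S\<^sup>2 - 2 * (S * cos \<beta>) * R = r\<^sup>2"
    proof -
      have "S\<^sup>2 = (s - R * sin e)\<^sup>2" using \<sigma> by (auto simp: Ss power2_commute)
      moreover have "L\<^sup>2 = R\<^sup>2 * (1 - (sin e)\<^sup>2)" by (simp add: Lc power_mult_distrib cs)
      ultimately show ?thesis
        unfolding RSc r2 by (simp add: power2_eq_square algebra_simps)
    qed
    then have "of_real (R\<^sup>2) + (of_real S)\<^sup>2 - 2 * of_real S * of_real (R * cos \<beta>) = complex_of_real (r\<^sup>2)"
      by (metis (no_types, opaque_lifting) mult.assoc mult.commute of_real_add of_real_diff of_real_mult of_real_numeral of_real_power)
    then show ?thesis
      unfolding rho_def using r by (simp only: csqrt_of_real_power2 less_imp_le)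
  qed
  have cosd: "cos (e - a) = 2 * C\<^sup>2 - 1"
    using cos_double_cos[of "(e - a) / 2"] unfolding C_def by (metis nonzero_mult_div_cancel_left times_divide_eq_right zero_neq_numeral)
  have q: "q_fun R \<beta> (of_real S) = of_real ((sqrt (2 * r) * C)\<^sup>2)"
  proof -
    have "R - S * cos \<beta> + r = R * (1 - (sin e)\<^sup>2) + s * sin e + r"
      unfolding RSc by (simp add: power2_eq_square algebra_simps)
    also have "\<dots> = r * cos a * cos e + r * sin a * sin e + r"
      unfolding rca cs[symmetric] by (simp add: power2_eq_square)
    also have "\<dots> = r * cos (e - a) + r" by (simp add: cos_diff algebra_simps)
    also have "\<dots> = (sqrt (2 * r) * C)\<^sup>2"
      unfolding cosd using r by (simp add: power_mult_distrib algebra_simps)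
    finally have "R - S * cos \<beta> + r = (sqrt (2 * r) * C)\<^sup>2" .
    then show ?thesis
      unfolding q_fun_def rho by (metis of_real_add of_real_diff of_real_mult)
  qed
  have sq: "csqrt (q_fun R \<beta> (of_real S)) = of_real (sqrt (2 * r) * C)"
    unfolding q using r C by (intro csqrt_of_real_power2) simp
  have sind: "s * cos e - R * cos e * sin e = - (2 * r * sin ((e - a) / 2) * C)"
  proof -
    have "s * cos e - R * cos e * sin e = - (r * sin (e - a))"
      by (simp add: sin_diff algebra_simps flip: rca)
    moreover have "sin (e - a) = 2 * sin ((e - a) / 2) * C"
      using sin_double[of "(e - a) / 2"] unfolding C_def by (metis nonzero_mult_div_cancel_left times_divide_eq_right zero_neq_numeral)
    ultimately show ?thesis by simp
  qed
  have mu: "mu k R \<beta> (of_real S) = of_real (- \<sigma> * W_fun k e s L)"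
  proof -
    have "sqrt k * sin \<beta> * S / (sqrt (2 * r) * C) = - \<sigma> * W_fun k e s L"
    proof -
      have "sqrt k * sin \<beta> * S = \<sigma> * sqrt k * (s * cos e - R * cos e * sin e)"
        by (simp add: sc Ss algebra_simps)
      also have "\<dots> = - \<sigma> * (sqrt (2 * k) * (sqrt r * sin ((e - a) / 2))) * (sqrt (2 * r) * C)"
      proof -
        have "sqrt (2 * k) * sqrt r * sqrt (2 * r) = sqrt k * (sqrt (2 * r) * sqrt (2 * r))"
          by (simp add: real_sqrt_mult)
        also have "sqrt (2 * r) * sqrt (2 * r) = 2 * r" using r by simp
        finally have "sqrt (2 * k) * sqrt r * sqrt (2 * r) = sqrt k * (2 * r)" .
        moreover have "- \<sigma> * (sqrt (2 * k) * (sqrt r * sin ((e - a) / 2))) * (sqrt (2 * r) * C)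
            = - \<sigma> * (sqrt (2 * k) * sqrt r * sqrt (2 * r)) * (sin ((e - a) / 2) * C)"
          by (simp only: mult_ac)
        ultimately show ?thesis unfolding sind by simp
      qed
      finally show ?thesis
        using r C by (simp add: W_fun_def r_def a_def)
    qed
    then show ?thesis
      unfolding mu_eq sq by (metis of_real_divide of_real_mult)
  qed
  have alg: "sqrt k * (S - 2 * R * cos \<beta>) * (sqrt (2 * r) * C) / (2 * r * (r + R))
      = \<sigma> * (sqrt (k / (2 * r)) * sin ((e + a) / 2))"
  proof -
    define D where "D = sin ((e + a) / 2)"
    define M where "M = cos ((e + a) / 2)"
    have R: "R > 0" using L ce by (simp add: R_def)
    \<comment> \<open>The factor cos e lets R cos e = r cos a eliminate R, after which both sides
      become products of half-angle functions.\<close>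
    have "(s + R * sin e) * C * cos e = (r + R) * D * cos e"
    proof -
      have e1: "(e - a) / 2 + (e + a) / 2 = e" "(e + a) / 2 - (e - a) / 2 = a" "(e + a) / 2 + (e + a) / 2 = e + a"
        by (simp_all add: field_simps)
      have "(s + R * sin e) * cos e = r * sin (a + e)"
        by (simp add: sin_add algebra_simps flip: rca)
      also have "sin (a + e) = 2 * D * M"
        using sin_add[of "(e + a) / 2" "(e + a) / 2"] unfolding e1 D_def M_def by (simp add: add.commute)
      finally have 1: "(s + R * sin e) * cos e = r * (2 * D * M)" .
      have "cos e + cos a = 2 * M * C"
        using cos_add[of "(e - a) / 2" "(e + a) / 2"] cos_diff[of "(e + a) / 2" "(e - a) / 2"]
        unfolding e1 C_def M_def by simp
      moreover have "(r + R) * cos e = r * (cos e + cos a)"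
        using rca(1) by (simp add: algebra_simps)
      ultimately have 2: "(r + R) * cos e = r * (2 * M * C)" by (simp only:)
      have "(s + R * sin e) * C * cos e = C * ((s + R * sin e) * cos e)"
        by (simp only: mult_ac)
      also have "\<dots> = D * ((r + R) * cos e)"
        unfolding 1 2 by (simp only: mult_ac)
      finally show ?thesis by (simp only: mult_ac)
    qed
    then have key: "(s + R * sin e) * C = (r + R) * D" using ce by simp
    have "S - 2 * R * cos \<beta> = \<sigma> * (s + R * sin e)"
      by (simp add: Ss sc algebra_simps)
    then have num: "sqrt k * (S - 2 * R * cos \<beta>) * (sqrt (2 * r) * C) = \<sigma> * sqrt k * sqrt (2 * r) * ((r + R) * D)"
      unfolding key[symmetric] by (simp only: mult_ac)
    have "r + R \<noteq> 0" using r R by simp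
    then have "sqrt k * (S - 2 * R * cos \<beta>) * (sqrt (2 * r) * C) / (2 * r * (r + R))
        = \<sigma> * sqrt k * (sqrt (2 * r) / (2 * r)) * D"
      unfolding num by simp
    also have "sqrt (2 * r) / (2 * r) = 1 / sqrt (2 * r)"
      using r real_div_sqrt[of "2 * r"] by (simp add: field_simps)
    also have "\<sigma> * sqrt k * (1 / sqrt (2 * r)) * D = \<sigma> * (sqrt (k / (2 * r)) * D)"
      unfolding real_sqrt_divide by simp
    finally show ?thesis by (simp only: D_def)
  qed
  have "of_real (sqrt k) * (of_real S - of_real (2 * R * cos \<beta>)) * of_real (sqrt (2 * r) * C) /
      (2 * of_real r * (of_real r + of_real R)) = complex_of_real (\<sigma> * (sqrt (k / (2 * r)) * sin ((e + a) / 2)))"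
    unfolding alg[symmetric] by simp
  then have "g_reg k R \<beta> (of_real S) = exp (3 * of_real pi * \<i> / 4) / of_real (sqrt pi) *
      of_real (\<sigma> * (sqrt (k / (2 * r)) * sin ((e + a) / 2)))
     - \<i> * of_real (k * cos e) * F_fun (of_real (- \<sigma> * W_fun k e s L))"
    unfolding g_reg_def rho sq mu sc(1) by (simp only:)
  then show ?thesis
    unfolding exp_3_pi_i_4 R_def \<beta>_def S_def r_def a_def by simp
qed

section \<open>Shadow and lit forms of the normal derivative, and the decomposition of
  \<open>Psi\<close>\<close>

lemma strip_nc:
  assumes "0 < L" "\<bar>e\<bar> < pi / 2" "\<sigma> = 1 \<or> \<sigma> = -1"
  shows "strip (L / cos e) (pi / 2 + \<sigma> * e)" "L / cos e * sin (pi / 2 + \<sigma> * e) = L"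
proof -
  have c: "cos e > 0" using assms by (intro cos_gt_zero_pi) auto
  then show "strip (L / cos e) (pi / 2 + \<sigma> * e)"
    using assms by unfold_locales (auto simp: abs_if split: if_splits)
  show "L / cos e * sin (pi / 2 + \<sigma> * e) = L"
    using assms c by (auto simp: sin_add)
qed

lemma g_on_nc:
  assumes "0 < k" "0 < L" "\<bar>e\<bar> < pi / 2" "\<sigma> = 1 \<or> \<sigma> = -1"
  shows "g k (of_real x) (L / cos e) (pi / 2 + \<sigma> * e) = g_reg k (L / cos e) (pi / 2 + \<sigma> * e) (of_real x)"
proof -
  interpret strip "L / cos e" "pi / 2 + \<sigma> * e" by (rule strip_nc[OF assms(2-4)])
  show ?thesis
    using strip_nc(2)[OF assms(2-4)] assms(1,2)
    by (intro g_eq_g_reg) (simp_all add: strip_set_def)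
qed

text \<open>This is \<sigma> = -1, where \<open>mu\<close> equals W and no reflection occurs. The
  identity holds for every s, not only in the shadow.\<close>

lemma G_normal_shadow:
  assumes "0 < k" "0 < L" "\<bar>e\<bar> < pi / 2"
  shows "G_normal k e s L = exp (\<i> * of_real (k * r_nc L s)) *
    g k (of_real (L * tan e - s)) (L / cos e) (pi / 2 - e)"
proof -
  have "- \<i> * of_real (k * cos e) * F_fun (of_real (W_fun k e s L)) = - (\<i> * of_real (k * cos e) * F_fun (of_real (W_fun k e s L)))"
    by simp
  then show ?thesis
    using g_on_nc[OF assms, of "-1" "L * tan e - s"] g_reg_on_nc[OF assms, of "-1" s]
    by (simp add: G_normal_def)
qed

text \<open>This is \<sigma> = 1, where \<open>mu\<close> equals - W; \<open>F_fun_minus\<close>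
  then splits off the plane wave. Again s is arbitrary, so on the shadow boundary both forms are
  available and can be averaged.\<close>

lemma G_normal_lit:
  assumes "0 < k" "0 < L" "\<bar>e\<bar> < pi / 2"
  shows "G_normal k e s L = - (\<i> * of_real (k * cos e) * wave k e s L)
    - exp (\<i> * of_real (k * r_nc L s)) * g k (of_real (s - L * tan e)) (L / cos e) (pi / 2 + e)"
proof -
  have "g k (of_real (s - L * tan e)) (L / cos e) (pi / 2 + e) =
    - (exp (- \<i> * of_real pi / 4) / of_real (sqrt pi) *
         of_real (sqrt (k / (2 * r_nc L s)) * sin ((e + arg_nc s L) / 2)))
    - \<i> * of_real (k * cos e) * (exp (- \<i> * (of_real (W_fun k e s L))\<^sup>2) - F_fun (of_real (W_fun k e s L)))"
    using g_on_nc[OF assms, of 1 "s - L * tan e"] g_reg_on_nc[OF assms, of 1 s]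
    by (simp add: F_fun_minus)
  then show ?thesis
    unfolding G_normal_def wave_eq_exp_W[OF assms(2,1)] by (simp only:) (simp add: algebra_simps)
qed

text \<open>For e \<ge> 0 only \<open>G_normal k e\<close> changes its form, at s = y, and for e < 0
  only \<open>G_normal k (- e)\<close>, at s = - y; the other one is always taken in the lit form.
  At the excluded point \<alpha> = \<pi>, s = 0 the equation fails: \<open>Psi\<close> and
  \<open>Psi_GO\<close> vanish there, but \<open>V_fun\<close> equals i k.\<close>

lemma Psi_decomposition:
  assumes k: "0 < k" and L: "0 < L" and \<alpha>: "pi / 2 < \<alpha>" "\<alpha> < 3 * pi / 2"
    and s: "0 \<le> s" and corner: "\<not> (\<alpha> = pi \<and> s = 0)"
  shows "Psi k L \<alpha> s = Psi_GO k L \<alpha> s + V_fun k L \<alpha> s * exp (\<i> * of_real (k * r_nc L s))"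
proof -
  define e y R X where "e = pi - \<alpha>" and "y = L * tan e" and "R = L / cos e"
    and "X = exp (\<i> * complex_of_real (k * r_nc L s))"
  define Ui Ur where "Ui = normal_deriv (u_inc k \<alpha>) (nc_point L s)"
    and "Ur = normal_deriv (u_ref k \<alpha>) (nc_point L s)"
  have e: "\<bar>e\<bar> < pi / 2" "\<bar>- e\<bar> < pi / 2" and \<alpha>e: "\<alpha> - pi = - e"
    using \<alpha> by (auto simp: e_def abs_if)
  have Psi: "Psi k L \<alpha> s = 2 * (G_normal k e s L + G_normal k (- e) s L - Ur)"
    using Psi_eq_G_normal[OF L k] by (simp add: e_def Ur_def)
  have Ui: "Ui = - (\<i> * of_real (k * cos e) * wave k e s L)"
    and Ur: "Ur = - (\<i> * of_real (k * cos (- e)) * wave k (- e) s L)"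
    using normal_deriv_u_inc[OF L] normal_deriv_u_ref[OF L] by (simp_all add: Ui_def Ur_def e_def)
  have lit: "G_normal k e s L = Ui - X * g k (of_real (s - y)) R (pi / 2 + e)"
    and lit': "G_normal k (- e) s L = Ur - X * g k (of_real (s + y)) R (pi / 2 - e)"
    using G_normal_lit[OF k L e(1), of s] G_normal_lit[OF k L e(2), of s] unfolding Ui Ur
    by (simp_all add: y_def R_def X_def)
  have shadow: "G_normal k e s L = X * g k (of_real (y - s)) R (pi / 2 - e)"
    and shadow': "G_normal k (- e) s L = X * g k (of_real (- y - s)) R (pi / 2 + e)"
    using G_normal_shadow[OF k L e(1), of s] G_normal_shadow[OF k L e(2), of s]
    by (simp_all add: y_def R_def X_def)
  have GO: "Psi_GO k L \<alpha> s = 2 * (of_real (heaviside (s - y)) * Ui - of_real (heaviside (- y - s)) * Ur)"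
    by (simp add: Psi_GO_def s_SB_i_def s_SB_r_def \<alpha>e Ui_def Ur_def y_def flip: e_def)
  have V: "V_fun k L \<alpha> s = 2 *
     (- of_real (heaviside (s - \<bar>y\<bar>)) * g k (of_real (s - \<bar>y\<bar>)) R (pi / 2 + \<bar>e\<bar>)
      + of_real (heaviside (\<bar>y\<bar> - s)) * g k (of_real (\<bar>y\<bar> - s)) R (pi / 2 - \<bar>e\<bar>)
      - g k (of_real (s + \<bar>y\<bar>)) R (pi / 2 - \<bar>e\<bar>))"
    using L by (simp add: V_fun_def s_SB_def g_plus_def g_minus_def y_def R_def abs_mult flip: e_def)
  show ?thesis
  proof (cases "0 \<le> e")
    case True
    \<comment> \<open>Strictness rules out the value 1/2 of the Heaviside function; for e = 0 it
      rests on the corner assumption.\<close>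
    have "0 < y + s"
    proof (cases "e = 0")
      case True
      with corner s show ?thesis by (auto simp: y_def e_def)
    next
      case False
      with \<open>0 \<le> e\<close> e L s show ?thesis
        by (simp add: y_def tan_gt_zero add_pos_nonneg)
    qed
    moreover have y0: "0 \<le> y"
      using True e L by (cases "e = 0") (auto simp: y_def less_imp_le tan_gt_zero)
    ultimately have H: "heaviside (- y - s) = 0" by (simp add: heaviside_def)
    consider "s < y" | "s > y" | "s = y" by linarith
    then show ?thesis
    proof cases
      case 1
      then show ?thesis
        unfolding Psi GO V H X_def[symmetric] lit' shadow using True y0
        by (simp add: heaviside_def algebra_simps)
    next
      case 2
      then show ?thesis
        unfolding Psi GO V H X_def[symmetric] lit' lit using True y0
        by (simp add: heaviside_def algebra_simps)
    next
      case 3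
      have "G_normal k e s L = 1 / 2 * (Ui - X * g k 0 R (pi / 2 + e)) + 1 / 2 * (X * g k 0 R (pi / 2 - e))"
        using lit shadow 3 by simp
      then have "2 * G_normal k e s L = Ui - X * g k 0 R (pi / 2 + e) + X * g k 0 R (pi / 2 - e)"
        by (simp add: field_simps)
      then show ?thesis
        unfolding Psi GO V H X_def[symmetric] lit' using True y0 3
        by (simp add: heaviside_def algebra_simps)
    qed
  next
    case False
    \<comment> \<open>The incident wave now lights the whole side; the transition belongs to the
      reflected wave.\<close>
    have "0 < tan (- e)" using False e by (intro tan_gt_zero) auto
    then have y0: "y < 0" using L by (simp add: y_def mult_pos_neg)
    then have H: "heaviside (s - y) = 1" using s by (simp add: heaviside_def)
    consider "s < - y" | "s > - y" | "s = - y" by linarith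
    then show ?thesis
    proof cases
      case 1
      then show ?thesis
        unfolding Psi GO V H X_def[symmetric] lit shadow' using False y0
        by (simp add: heaviside_def algebra_simps)
    next
      case 2
      then show ?thesis
        unfolding Psi GO V H X_def[symmetric] lit' lit using False y0
        by (simp add: heaviside_def algebra_simps)
    next
      case 3
      have "G_normal k (- e) s L = 1 / 2 * (Ur - X * g k 0 R (pi / 2 - e)) + 1 / 2 * (X * g k 0 R (pi / 2 + e))"
        using lit' shadow' 3 by simp
      then have "2 * G_normal k (- e) s L = Ur - X * g k 0 R (pi / 2 - e) + X * g k 0 R (pi / 2 + e)"
        by (simp add: field_simps)
      then show ?thesis
        unfolding Psi GO V H X_def[symmetric] lit using False y0 3
        by (simp add: heaviside_def algebra_simps)
    qed
  qed
qed

section \<open>Transfer to \<open>g_plus\<close> and \<open>g_minus\<close>, uniformly in the angle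
  of incidence\<close>

lemma strip_incidence:
  assumes "0 < L" "pi / 2 < a" "a < 3 * pi / 2" "\<sigma> = 1 \<or> \<sigma> = -1"
  shows "strip (L / cos (pi - a)) (pi / 2 + \<sigma> * \<bar>pi - a\<bar>)"
    "L / cos (pi - a) * sin (pi / 2 + \<sigma> * \<bar>pi - a\<bar>) = L"
proof -
  have "\<bar>\<bar>pi - a\<bar>\<bar> < pi / 2" using assms by (auto simp: abs_if)
  moreover have "cos \<bar>pi - a\<bar> = cos (pi - a)" by (rule cos_abs_real)
  ultimately show "strip (L / cos (pi - a)) (pi / 2 + \<sigma> * \<bar>pi - a\<bar>)"
    "L / cos (pi - a) * sin (pi / 2 + \<sigma> * \<bar>pi - a\<bar>) = L"
    using strip_nc[of L "\<bar>pi - a\<bar>" \<sigma>] assms(1,4) by simp_all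
qed

lemma norm_g_plus_minus_le:
  assumes k: "0 < k" and L: "0 < L" and a: "pi / 2 < a" "a < 3 * pi / 2" and \<delta>: "0 < \<delta>"
    and s: "s \<in> S_region L \<delta>" and \<kappa>: "0 < \<kappa>" "\<kappa> \<le> k * L"
  defines "C \<equiv> 3 / 2 * sqrt ((2 + 2 / \<delta>) / (\<delta> * \<kappa>)) + 3 / 2"
  shows "norm (g_plus k L a s) \<le> C * k" "norm (g_minus k L a s) \<le> C * k"
proof -
  have "norm (g k s (L / cos (pi - a)) (pi / 2 + \<sigma> * \<bar>pi - a\<bar>)) \<le> C * k" if "\<sigma> = 1 \<or> \<sigma> = -1" for \<sigma>
    unfolding C_def
    using strip.norm_g_le[OF strip_incidence(1)[OF L a that] k \<delta>, unfolded strip_incidence(2)[OF L a that], OF s \<kappa>] .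
  from this[of 1] this[of "-1"] show "norm (g_plus k L a s) \<le> C * k" "norm (g_minus k L a s) \<le> C * k"
    by (simp_all add: g_plus_def g_minus_def)
qed

lemma g_plus_minus_analytic_on:
  assumes k: "0 < k" and L: "0 < L" and a: "pi / 2 < a" "a < 3 * pi / 2" and \<delta>: "0 < \<delta>"
  shows "g_plus k L a analytic_on S_region L \<delta>" "g_minus k L a analytic_on S_region L \<delta>"
proof -
  have "(\<lambda>s. g k s (L / cos (pi - a)) (pi / 2 + \<sigma> * \<bar>pi - a\<bar>)) analytic_on S_region L \<delta>"
    if "\<sigma> = 1 \<or> \<sigma> = -1" for \<sigma>
    using strip.g_analytic_on[OF strip_incidence(1)[OF L a that] k \<delta>, unfolded strip_incidence(2)[OF L a that]] .
  from this[of 1] this[of "-1"]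
  show "g_plus k L a analytic_on S_region L \<delta>" "g_minus k L a analytic_on S_region L \<delta>"
    by (simp_all add: g_plus_def[abs_def] g_minus_def[abs_def])
qed

text \<open>In the last conjunct \<open>C\<close> is chosen before the geometry, the angle and the
  wave numbers, which expresses dependence on \<delta> and \<open>\<kappa>\<close> alone. The known
  decomposition enters as a premise on \<open>u\<close>, \<open>vp\<close>, \<open>vm\<close> and
  \<open>v\<close>.\<close>

theorem theorem2p2:
  fixes Lnc Lnc' \<alpha> :: real and S :: point and N :: "complex set"
  assumes "Lnc > 0" "Lnc' > 0"
    and "fst S > 0" "snd S < -Lnc'"
    and "pi / 2 < \<alpha>" "\<alpha> < 3 * pi / 2"
    and "open N" "of_real ` {0..Lnc} \<subseteq> N"
  shows
    "(\<forall>k>0.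
        (\<forall>s\<in>{0..Lnc}. \<not> (\<alpha> = pi \<and> s = 0) \<longrightarrow>
           Psi k Lnc' \<alpha> s =
             Psi_GO k Lnc' \<alpha> s + V_fun k Lnc' \<alpha> s * exp (\<i> * of_real (k * r_nc Lnc' s)))
        \<and>
        (\<forall>u vp vm v.
           total_field Lnc Lnc' S k \<alpha> u \<and>
           vp analytic_on {z. Re z > 0} \<and> vm analytic_on {z. Re z > 0} \<and> v analytic_on N \<and>
           (\<forall>s\<in>{0..Lnc}.
              normal_deriv u (nc_point Lnc' s) =
                Psi k Lnc' \<alpha> s
                + vp (of_real (Lnc + s)) * exp (\<i> * of_real (k * s))
                + vm (of_real (Lnc - s)) * exp (- \<i> * of_real (k * s))
                + v (of_real s) * exp (\<i> * of_real (k * r_nc Lnc' s)))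
           \<longrightarrow>
           (\<forall>s\<in>{0..Lnc}. \<not> (\<alpha> = pi \<and> s = 0) \<longrightarrow>
              normal_deriv u (nc_point Lnc' s) =
                Psi_GO k Lnc' \<alpha> s
                + vp (of_real (Lnc + s)) * exp (\<i> * of_real (k * s))
                + vm (of_real (Lnc - s)) * exp (- \<i> * of_real (k * s))
                + (v (of_real s) + V_fun k Lnc' \<alpha> s) * exp (\<i> * of_real (k * r_nc Lnc' s))))
        \<and>
        (\<forall>\<delta>. 0 < \<delta> \<and> \<delta> < 1 \<longrightarrow>
           g_plus k Lnc' \<alpha> analytic_on S_region Lnc' \<delta> \<and>
           g_minus k Lnc' \<alpha> analytic_on S_region Lnc' \<delta> \<and>
           bounded (g_plus k Lnc' \<alpha> ` S_region Lnc' \<delta>) \<and>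
           bounded (g_minus k Lnc' \<alpha> ` S_region Lnc' \<delta>)))
     \<and>
     (\<forall>\<delta> \<kappa> :: real. 0 < \<delta> \<and> \<delta> < 1 \<and> 0 < \<kappa> \<longrightarrow>
        (\<exists>C>0. \<forall>L' a k\<^sub>0 k. \<forall>s\<in>S_region L' \<delta>.
           0 < L' \<and> pi / 2 < a \<and> a < 3 * pi / 2 \<and> 0 < k\<^sub>0 \<and> k\<^sub>0 * L' = \<kappa> \<and> k\<^sub>0 \<le> k \<longrightarrow>
             norm (g_plus k L' a s) \<le> C * k \<and> norm (g_minus k L' a s) \<le> C * k))"
proof (intro conjI allI impI ballI)
  fix k s :: real
  assume "0 < k" "s \<in> {0..Lnc}" "\<not> (\<alpha> = pi \<and> s = 0)"
  with assms show "Psi k Lnc' \<alpha> s =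
      Psi_GO k Lnc' \<alpha> s + V_fun k Lnc' \<alpha> s * exp (\<i> * of_real (k * r_nc Lnc' s))"
    by (intro Psi_decomposition) auto
next
  fix k s :: real and u vp vm v
  assume k: "0 < k" and s: "s \<in> {0..Lnc}" and corner: "\<not> (\<alpha> = pi \<and> s = 0)"
    and u: "total_field Lnc Lnc' S k \<alpha> u \<and>
           vp analytic_on {z. Re z > 0} \<and> vm analytic_on {z. Re z > 0} \<and> v analytic_on N \<and>
           (\<forall>s\<in>{0..Lnc}.
              normal_deriv u (nc_point Lnc' s) =
                Psi k Lnc' \<alpha> s
                + vp (of_real (Lnc + s)) * exp (\<i> * of_real (k * s))
                + vm (of_real (Lnc - s)) * exp (- \<i> * of_real (k * s))
                + v (of_real s) * exp (\<i> * of_real (k * r_nc Lnc' s)))"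
  have "Psi k Lnc' \<alpha> s =
      Psi_GO k Lnc' \<alpha> s + V_fun k Lnc' \<alpha> s * exp (\<i> * of_real (k * r_nc Lnc' s))"
    using assms k s corner by (intro Psi_decomposition) auto
  moreover have "normal_deriv u (nc_point Lnc' s) =
                Psi k Lnc' \<alpha> s
                + vp (of_real (Lnc + s)) * exp (\<i> * of_real (k * s))
                + vm (of_real (Lnc - s)) * exp (- \<i> * of_real (k * s))
                + v (of_real s) * exp (\<i> * of_real (k * r_nc Lnc' s))"
    using u s by blast
  ultimately show "normal_deriv u (nc_point Lnc' s) =
                Psi_GO k Lnc' \<alpha> s
                + vp (of_real (Lnc + s)) * exp (\<i> * of_real (k * s))
                + vm (of_real (Lnc - s)) * exp (- \<i> * of_real (k * s))
                + (v (of_real s) + V_fun k Lnc' \<alpha> s) * exp (\<i> * of_real (k * r_nc Lnc' s))"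
    by (simp only: distrib_right add_ac)
next
  fix k \<delta> :: real
  assume k: "0 < k" and \<delta>: "0 < \<delta> \<and> \<delta> < 1"
  with assms show "g_plus k Lnc' \<alpha> analytic_on S_region Lnc' \<delta>" "g_minus k Lnc' \<alpha> analytic_on S_region Lnc' \<delta>"
    by (auto intro!: g_plus_minus_analytic_on)
  have "0 < k * Lnc'" using k assms by simp
  then show "bounded (g_plus k Lnc' \<alpha> ` S_region Lnc' \<delta>)" "bounded (g_minus k Lnc' \<alpha> ` S_region Lnc' \<delta>)"
    unfolding bounded_iff using norm_g_plus_minus_le[of k Lnc' \<alpha> \<delta> _ "k * Lnc'"] k \<delta> assms by blast+
next
  fix \<delta> \<kappa> :: real
  assume h: "0 < \<delta> \<and> \<delta> < 1 \<and> 0 < \<kappa>"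
  define C where "C = 3 / 2 * sqrt ((2 + 2 / \<delta>) / (\<delta> * \<kappa>)) + 3 / 2"
  have "C > 0" using h by (simp add: C_def add_nonneg_pos)
  moreover have "norm (g_plus k L' a s) \<le> C * k \<and> norm (g_minus k L' a s) \<le> C * k"
    if "s \<in> S_region L' \<delta>"
      "0 < L' \<and> pi / 2 < a \<and> a < 3 * pi / 2 \<and> 0 < k\<^sub>0 \<and> k\<^sub>0 * L' = \<kappa> \<and> k\<^sub>0 \<le> k" for L' a k\<^sub>0 k s
  proof -
    have "\<kappa> \<le> k * L'" using that(2) by (auto intro!: mult_right_mono)
    with norm_g_plus_minus_le[of k L' a \<delta> s \<kappa>] h that show ?thesis by (simp add: C_def)
  qed
  ultimately show "\<exists>C>0. \<forall>L' a k\<^sub>0 k. \<forall>s\<in>S_region L' \<delta>.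
      0 < L' \<and> pi / 2 < a \<and> a < 3 * pi / 2 \<and> 0 < k\<^sub>0 \<and> k\<^sub>0 * L' = \<kappa> \<and> k\<^sub>0 \<le> k \<longrightarrow>
        norm (g_plus k L' a s) \<le> C * k \<and> norm (g_minus k L' a s) \<le> C * k"
    by blast
qed

end
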